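(* Let $T$ be a tree on $n\ge4$ vertices, let $v_1$ and $v_c$ be two non-adjacent vertices of $T$, let $v_1,v_2,\dots,v_c$ be the unique path in $T$ from $v_1$ to $v_c$ (so $c\ge3$), and let $G$ be the graph obtained from $T$ by adding the edge $v_1v_c$. Then $$\begin{aligned}\mathcal{K}(G)-\mathcal{K}(T)\ge\frac{1}{4cn(n-1)}\Big\{&-\tfrac{2}{3}(n+1)c^2(c^2-1)-8(n-c)\Big(-nc^2+\tfrac{c(c+1)}{6}\big((2n+1)c+n-1\big)\Big)\\&-8\left\lfloor\tfrac{n-c}{2}\right\rfloor\left\lceil\tfrac{n-c}{2}\right\rceil\big((n-1)(c-1)^2+c(c-1)\big)+4n(n-1)c(c-1)+2(n-1)c^2\Big\},\end{aligned}$$ with equality if and only if $T$ is formed from the path $v_1,v_2,\dots,v_c$ by appending $\lfloor\frac{n-c}{2}\rfloor$ pendent vertices at one of its end points and $\lceil\frac{n-c}{2}\rceil$ pendent vertices at the other end point.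
   Context: Kemeny's constant: for a connected graph $H$ with adjacency matrix $A$ and diagonal degree matrix $\Delta$, consider the random walk with transition matrix $\Delta^{-1}A$, its stationary distribution $w=(w_k)$ and mean first passage times $m_{j,k}$; then $\mathcal{K}(H)=\sum_{k\neq j} m_{j,k}w_k$, which is independent of $j$. *)

theory Defs
  imports Complex_Main
begin

definition simple_graph :: "'a set \<Rightarrow> ('a \<Rightarrow> 'a \<Rightarrow> bool) \<Rightarrow> bool" where
  "simple_graph V E \<longleftrightarrow> finite V \<and>
     (\<forall>x y. E x y \<longrightarrow> x \<in> V \<and> y \<in> V \<and> x \<noteq> y \<and> E y x)"

definition is_path :: "('a \<Rightarrow> 'a \<Rightarrow> bool) \<Rightarrow> 'a list \<Rightarrow> bool" where
  "is_path E vs \<longleftrightarrow> distinct vs \<and> (\<forall>i. Suc i < length vs \<longrightarrow> E (vs ! i) (vs ! Suc i))"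

definition connected_graph :: "'a set \<Rightarrow> ('a \<Rightarrow> 'a \<Rightarrow> bool) \<Rightarrow> bool" where
  "connected_graph V E \<longleftrightarrow>
     (\<forall>x\<in>V. \<forall>y\<in>V. \<exists>vs. is_path E vs \<and> vs \<noteq> [] \<and> hd vs = x \<and> last vs = y)"

definition has_cycle :: "('a \<Rightarrow> 'a \<Rightarrow> bool) \<Rightarrow> bool" where
  "has_cycle E \<longleftrightarrow> (\<exists>vs. length vs \<ge> 3 \<and> is_path E vs \<and> E (last vs) (hd vs))"

definition is_tree :: "'a set \<Rightarrow> ('a \<Rightarrow> 'a \<Rightarrow> bool) \<Rightarrow> bool" where
  "is_tree V E \<longleftrightarrow> simple_graph V E \<and> V \<noteq> {} \<and> connected_graph V E \<and> \<not> has_cycle E"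

definition add_edge :: "('a \<Rightarrow> 'a \<Rightarrow> bool) \<Rightarrow> 'a \<Rightarrow> 'a \<Rightarrow> 'a \<Rightarrow> 'a \<Rightarrow> bool" where
  "add_edge E a b = (\<lambda>x y. E x y \<or> (x = a \<and> y = b) \<or> (x = b \<and> y = a))"

definition deg :: "'a set \<Rightarrow> ('a \<Rightarrow> 'a \<Rightarrow> bool) \<Rightarrow> 'a \<Rightarrow> nat" where
  "deg V E x = card {y \<in> V. E x y}"

definition trans_prob :: "'a set \<Rightarrow> ('a \<Rightarrow> 'a \<Rightarrow> bool) \<Rightarrow> 'a \<Rightarrow> 'a \<Rightarrow> real" where
  "trans_prob V E x y = (if E x y then 1 / real (deg V E x) else 0)"

text \<open>Stationary distribution (unique for a connected graph); extended by 0 outside V.\<close>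
definition is_stationary :: "'a set \<Rightarrow> ('a \<Rightarrow> 'a \<Rightarrow> bool) \<Rightarrow> ('a \<Rightarrow> real) \<Rightarrow> bool" where
  "is_stationary V E w \<longleftrightarrow> (\<forall>k. k \<notin> V \<longrightarrow> w k = 0) \<and> (\<forall>k\<in>V. w k \<ge> 0) \<and>
     (\<forall>k\<in>V. w k = (\<Sum>j\<in>V. w j * trans_prob V E j k)) \<and> (\<Sum>k\<in>V. w k) = 1"

definition stat_dist :: "'a set \<Rightarrow> ('a \<Rightarrow> 'a \<Rightarrow> bool) \<Rightarrow> 'a \<Rightarrow> real" where
  "stat_dist V E = (THE w. is_stationary V E w)"

primrec first_passage_prob :: "'a set \<Rightarrow> ('a \<Rightarrow> 'a \<Rightarrow> bool) \<Rightarrow> nat \<Rightarrow> 'a \<Rightarrow> 'a \<Rightarrow> real" where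
  "first_passage_prob V E 0 j k = 0"
| "first_passage_prob V E (Suc t) j k =
     (if t = 0 then trans_prob V E j k
      else (\<Sum>l\<in>V - {k}. trans_prob V E j l * first_passage_prob V E t l k))"

definition mfpt :: "'a set \<Rightarrow> ('a \<Rightarrow> 'a \<Rightarrow> bool) \<Rightarrow> 'a \<Rightarrow> 'a \<Rightarrow> real" where
  "mfpt V E j k = (\<Sum>t. real t * first_passage_prob V E t j k)"

text \<open>Kemeny's constant, computed from an (arbitrary) vertex j; it is independent of j.\<close>
definition kemeny :: "'a set \<Rightarrow> ('a \<Rightarrow> 'a \<Rightarrow> bool) \<Rightarrow> real" where
  "kemeny V E = (let j = (SOME j. j \<in> V) in
     (\<Sum>k\<in>V - {j}. mfpt V E j k * stat_dist V E k))"

end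

theory Submission
  imports Defs
begin

text \<open>For a function \<open>R\<close> whose Laplacian behaves like that of the effective resistance, Kemeny's
  constant is \<open>(\<Sum>x y. deg x * deg y * R x y) / (4 m)\<close>, \<open>m\<close> being the number of edges. In the tree
  \<open>R\<close> is the distance \<open>d\<close>; the new edge is a rank-one perturbation of the Laplacian and turns it into
  \<open>d x y - (pos x - pos y)\<^sup>2 / c\<close>, where \<open>pos x\<close> is the position on the path of the branch of \<open>x\<close>.
  Let \<open>ht x\<close> be the distance of \<open>x\<close> from the path. Since
  \<open>d x y \<le> ht x + ht y + \<bar>pos x - pos y\<bar>\<close>, and the heights cancel from the difference of the two
  constants when equality holds for all \<open>x \<noteq> y\<close>, minimising that difference amounts to maximising
  \<open>\<Sum>x y. \<bar>pos x - pos y\<bar> + (n - 1) / c * (pos x - pos y)\<^sup>2\<close>. Pairs of an off-path and a path vertex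
  contribute most when the former sits over an end point, and pairs of off-path vertices when
  these are split evenly between the two ends.\<close>

section \<open>Kemeny's constant from effective resistance\<close>

text \<open>Mean first passage times are defined by infinite series and the stationary distribution
  by \<open>THE\<close>, so no matrix is inverted: candidates are written down and verified, the
  times through their linear recurrence and the distribution through uniqueness.

  When the difference is multiplied by \<open>4 n (n - 1)\<close>, the sum in \<open>K(G)\<close>
  gets weight \<open>n - 1\<close> and the one in \<open>K(T)\<close> weight \<open>n\<close>, while
  both contain the same degree-weighted sum of tree distances. That sum survives with coefficient
  -1, so a lower bound for the difference calls for an upper bound on distances; this is why the
  triangle inequality through the path is the right estimate.

  The bound comes out of an exact identity: the difference equals the bound plus three non-negative
  slack terms, namely the loss in that triangle inequality, the cost of off-path vertices over inner
  path vertices, and the shortfall of the mutual spread of the off-path vertices. The equality case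
  is the simultaneous vanishing of the three.\<close>

lemma first_passage_mean:
  fixes V :: "'a set" and h :: "'a \<Rightarrow> real"
  assumes fin: "finite V" and k: "k \<in> V"
    and row: "\<And>j. j \<in> V \<Longrightarrow> (\<Sum>l\<in>V. trans_prob V E j l) = 1"
    and hk: "h k = 0"
    and heq: "\<And>j. j \<in> V \<Longrightarrow> j \<noteq> k \<Longrightarrow> h j = 1 + (\<Sum>l\<in>V. trans_prob V E j l * h l)"
    and j: "j \<in> V" "j \<noteq> k"
  shows "mfpt V E j k = h j"
proof -
  let ?P = "trans_prob V E"
  have P0: "?P x y \<ge> 0" for x y by (simp add: trans_prob_def)
  \<comment> \<open>\<open>Q\<close> is one step of the walk killed on entering \<open>k\<close>.
    Thus \<open>q t x\<close> is the probability that steps 1 to \<open>t\<close> avoid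
    \<open>k\<close>, and away from \<open>k\<close> the vector \<open>r t\<close> will turn out to
    be the tail \<open>q t + q (t + 1) + ...\<close>.\<close>
  define Q where "Q u x = (\<Sum>l\<in>V - {k}. ?P x l * u l)" for u :: "'a \<Rightarrow> real" and x
  define q where "q t = (Q ^^ t) (\<lambda>_. 1)" for t
  define r where "r t = (Q ^^ t) h" for t
  have q0: "q 0 x = 1" and qS: "q (Suc t) = Q (q t)" for t x by (simp_all add: q_def)
  have r0: "r 0 = h" and rS: "r (Suc t) = Q (r t)" for t by (simp_all add: r_def)
  have Qmono: "Q u x \<le> Q w x" if "\<And>l. l \<in> V - {k} \<Longrightarrow> u l \<le> w l" for u w x
    unfolding Q_def by (intro sum_mono mult_left_mono that P0)
  have Qcong: "Q u x = Q w x" if "\<And>l. l \<in> V - {k} \<Longrightarrow> u l = w l" for u w x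
    unfolding Q_def by (intro sum.cong refl) (simp add: that)
  have Qdiff: "Q (\<lambda>x. u x - w x) x = Q u x - Q w x" for u w x
    by (simp add: Q_def algebra_simps sum_subtractf)
  have Qscale: "Q (\<lambda>x. b * u x) x = b * Q u x" for u b x
    by (simp add: Q_def sum_distrib_left algebra_simps)
  have Qh: "h x = 1 + Q h x" if "x \<in> V - {k}" for x
    using heq[of x] that k fin hk by (simp add: Q_def sum.remove[of V k])
  have fp: "first_passage_prob V E (Suc t) x k = q t x - q (Suc t) x" if "x \<in> V" for t x
    using that
  proof (induction t arbitrary: x)
    case 0
    then show ?case using row[of x] k fin by (simp add: qS q0 Q_def sum.remove[of V k])
  next
    case (Suc t)
    have "first_passage_prob V E (Suc (Suc t)) x k = Q (\<lambda>l. first_passage_prob V E (Suc t) l k) x"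
      by (simp add: Q_def)
    also have "\<dots> = Q (\<lambda>l. q t l - q (Suc t) l) x" by (rule Qcong) (use Suc.IH in auto)
    finally show ?case by (simp add: Qdiff qS)
  qed
  \<comment> \<open>minimum principle: at a minimum of \<open>h\<close> away from \<open>k\<close> the recurrence would give \<open>h x \<ge> 1 + h x\<close>\<close>
  have h0: "h x \<ge> 0" if "x \<in> V" for x
  proof -
    obtain y where y: "y \<in> V" "\<And>z. z \<in> V \<Longrightarrow> h y \<le> h z"
    proof -
      have "Min (h ` V) \<in> h ` V" using fin k by (intro Min_in) auto
      then obtain y where "y \<in> V" "h y = Min (h ` V)" by auto
      then show thesis using that[of y] fin by simp
    qed
    have "y = k"
    proof (rule ccontr)
      assume "y \<noteq> k"
      have "h y = (\<Sum>l\<in>V. ?P y l * h y)" using row[OF y(1)] by (simp flip: sum_distrib_right)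
      also have "\<dots> \<le> (\<Sum>l\<in>V. ?P y l * h l)" by (intro sum_mono mult_left_mono y P0)
      finally show False using heq[OF y(1) \<open>y \<noteq> k\<close>] by simp
    qed
    with y(2)[OF that] hk show ?thesis by simp
  qed
  have h1: "h x \<ge> 1" if "x \<in> V - {k}" for x
  proof -
    have "Q h x \<ge> 0" unfolding Q_def by (intro sum_nonneg mult_nonneg_nonneg P0 h0) auto
    then show ?thesis using Qh[OF that] by simp
  qed
  \<comment> \<open>Away from \<open>k\<close> the recurrence reads \<open>Q h = h - 1\<close>, and
    \<open>h \<le> M\<close> makes this at most \<open>(1 - 1 / M) * h\<close>. So the mere
    existence of \<open>h\<close> forces geometric decay, and with it convergence of the
    series.\<close>
  define M where "M = Max (h ` (V - {k}))"
  have hM: "h x \<le> M" if "x \<in> V - {k}" for x using that fin by (simp add: M_def)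
  have M1: "M \<ge> 1" using h1[of j] hM[of j] j by simp
  define \<rho> where "\<rho> = 1 - 1 / M"
  have \<rho>: "0 \<le> \<rho>" "\<rho> < 1" using M1 by (auto simp: \<rho>_def)
  have rle: "r t x \<le> \<rho> ^ t * h x" if "x \<in> V - {k}" for t x using that
  proof (induction t arbitrary: x)
    case 0 then show ?case by (simp add: r0)
  next
    case (Suc t)
    have "r (Suc t) x \<le> Q (\<lambda>l. \<rho> ^ t * h l) x" unfolding rS by (rule Qmono) (rule Suc.IH)
    also have "\<dots> = \<rho> ^ t * (h x - 1)" using Qh[OF Suc.prems] by (simp add: Qscale)
    also have "\<dots> \<le> \<rho> ^ t * (\<rho> * h x)"
    proof (rule mult_left_mono)
      show "h x - 1 \<le> \<rho> * h x" using hM[OF Suc.prems] M1 by (simp add: \<rho>_def field_simps)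
    qed (use \<rho> in simp)
    finally show ?case by (simp add: mult_ac)
  qed
  have qr: "0 \<le> q t x \<and> q t x \<le> r t x" if "x \<in> V - {k}" for t x using that
  proof (induction t arbitrary: x)
    case 0 then show ?case by (simp add: r0 q0 h1)
  next
    case (Suc t)
    have "0 \<le> Q (q t) x" unfolding Q_def by (intro sum_nonneg mult_nonneg_nonneg P0) (use Suc.IH in auto)
    moreover have "Q (q t) x \<le> Q (r t) x" by (rule Qmono) (use Suc.IH in auto)
    ultimately show ?case by (simp add: qS rS)
  qed
  have tele: "q t x = r t x - r (Suc t) x" if "x \<in> V - {k}" for t x using that
  proof (induction t arbitrary: x)
    case 0 then show ?case using Qh[of x] by (simp add: r0 rS q0)
  next
    case (Suc t)
    have "q (Suc t) x = Q (\<lambda>l. r t l - r (Suc t) l) x" unfolding qS by (rule Qcong) (rule Suc.IH)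
    then show ?case by (simp add: Qdiff rS)
  qed
  have jV: "j \<in> V - {k}" using j by simp
  have \<rho>lim: "(\<lambda>t. \<rho> ^ t * h j) \<longlonglongrightarrow> 0"
    by (intro tendsto_mult_left_zero LIMSEQ_realpow_zero \<rho>)
  have rlim: "(\<lambda>t. r t j) \<longlonglongrightarrow> 0"
  proof (rule tendsto_sandwich[OF _ _ tendsto_const \<rho>lim])
    show "\<forall>\<^sub>F t in sequentially. 0 \<le> r t j" using qr[OF jV] order_trans by (intro always_eventually) blast
  qed (simp add: rle[OF jV])
  have tlim: "(\<lambda>t. (real t * \<rho> ^ t) * h j) \<longlonglongrightarrow> 0"
    by (intro tendsto_mult_left_zero powser_times_n_limit_0) (use \<rho> in simp)
  have nqlim: "(\<lambda>t. real t * q t j) \<longlonglongrightarrow> 0"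
  proof (rule tendsto_sandwich[OF _ _ tendsto_const tlim])
    show "\<forall>\<^sub>F t in sequentially. real t * q t j \<le> (real t * \<rho> ^ t) * h j"
    proof (intro always_eventually allI)
      fix t show "real t * q t j \<le> (real t * \<rho> ^ t) * h j"
        using qr[OF jV, of t] rle[OF jV, of t] by (simp add: mult.assoc mult_left_mono)
    qed
  qed (use qr[OF jV] in simp)
  \<comment> \<open>Summation by parts: the terms \<open>t * (q (t - 1) - q t)\<close> add up to the
    sum of \<open>q\<close> minus a boundary term, and the sum of \<open>q\<close> telescopes by
    \<open>tele\<close>.\<close>
  have part: "(\<Sum>t<Suc N. real t * first_passage_prob V E t j k) = h j - r N j - real N * q N j" for N
  proof (induction N)
    case 0 then show ?case by (simp add: r0)
  next
    case (Suc N)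
    have "r N j = q N j + r (Suc N) j" using tele[OF jV, of N] by simp
    then show ?case unfolding sum.lessThan_Suc[of _ "Suc N"] Suc.IH fp[OF j(1)]
      by (simp add: algebra_simps)
  qed
  have "(\<lambda>N. h j - r N j - real N * q N j) \<longlonglongrightarrow> h j - 0 - 0"
    by (intro tendsto_diff tendsto_const rlim nqlim)
  then have "(\<lambda>N. \<Sum>t<N. real t * first_passage_prob V E t j k) \<longlonglongrightarrow> h j"
    unfolding part[symmetric] by (subst (asm) filterlim_sequentially_Suc) simp
  then have "(\<lambda>t. real t * first_passage_prob V E t j k) sums h j" by (simp add: sums_def)
  then show ?thesis by (simp add: mfpt_def sums_unique[symmetric])
qed

lemma sum_trans_prob:
  fixes V :: "'a set" and f :: "'a \<Rightarrow> real"
  assumes "finite V"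
  shows "(\<Sum>l\<in>V. trans_prob V E j l * f l) = (\<Sum>l\<in>{l\<in>V. E j l}. f l) / deg V E j"
proof -
  have "(\<Sum>l\<in>V. trans_prob V E j l * f l) = (\<Sum>l\<in>V. if E j l then f l / deg V E j else 0)"
    by (intro sum.cong) (auto simp: trans_prob_def)
  also have "\<dots> = (\<Sum>l\<in>{l\<in>V. E j l}. f l / deg V E j)" using assms by (simp add: sum.inter_filter)
  finally show ?thesis by (simp add: sum_divide_distrib)
qed

lemma connected_closed_subset:
  assumes "connected_graph V E" and "x \<in> S" "x \<in> V" "y \<in> V"
    and closed: "\<And>u v. u \<in> S \<Longrightarrow> E u v \<Longrightarrow> v \<in> S"
  shows "y \<in> S"
proof -
  obtain vs where vs: "is_path E vs" "vs \<noteq> []" "hd vs = x" "last vs = y"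
    using assms(1) \<open>x \<in> V\<close> \<open>y \<in> V\<close> unfolding connected_graph_def by blast
  have "i < length vs \<Longrightarrow> vs ! i \<in> S" for i
  proof (induction i)
    case 0 then show ?case using vs \<open>x \<in> S\<close> by (simp add: hd_conv_nth)
  next
    case (Suc i) then show ?case using vs closed by (auto simp: is_path_def)
  qed
  from this[of "length vs - 1"] show ?thesis using vs by (simp add: last_conv_nth)
qed

lemma deg_pos:
  assumes "simple_graph V E" "connected_graph V E" "card V \<ge> 2" "x \<in> V"
  shows "deg V E x > 0"
proof -
  obtain y where y: "y \<in> V" "y \<noteq> x"
    using assms(3) card_mono[of "{x}" V] by force
  have "\<exists>z. E x z"
    using connected_closed_subset[OF assms(2), of x "{x}" y] y assms(4) by auto
  then obtain z where "E x z" ..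
  then have "z \<in> {y \<in> V. E x y}" "finite {y \<in> V. E x y}" using assms(1) by (auto simp: simple_graph_def)
  then show ?thesis unfolding deg_def by (metis card_gt_0_iff empty_iff)
qed

text \<open>Since \<open>stat_dist\<close> is a \<open>THE\<close>, uniqueness is the real content.
  Divided by the degrees, a stationary vector is harmonic because edges are symmetric, and the
  maximum principle spreads its maximal value along edges to all of \<open>V\<close>.\<close>

lemma stat_dist_eq:
  assumes sg: "simple_graph V E" and con: "connected_graph V E" and n2: "card V \<ge> 2" and x: "x \<in> V"
  shows "stat_dist V E x = deg V E x / (\<Sum>k\<in>V. real (deg V E k))"
proof -
  have fin: "finite V" using sg by (simp add: simple_graph_def)
  have symE: "E x y \<longleftrightarrow> E y x" for x y using sg by (auto simp: simple_graph_def)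
  let ?d = "\<lambda>x. real (deg V E x)"
  let ?D = "\<Sum>k\<in>V. ?d k"
  have dpos: "?d x > 0" if "x \<in> V" for x using deg_pos[OF sg con n2 that] by simp
  have Dpos: "?D > 0" using dpos x fin by (intro sum_pos) auto
  define w0 where "w0 k = (if k \<in> V then ?d k / ?D else 0)" for k
  have flow: "(\<Sum>j\<in>V. w j * trans_prob V E j k) = (\<Sum>j\<in>{j\<in>V. E k j}. w j / ?d j)" for w k
  proof -
    have "(\<Sum>j\<in>V. w j * trans_prob V E j k) = (\<Sum>j\<in>V. if E k j then w j / ?d j else 0)"
      by (intro sum.cong) (auto simp: trans_prob_def symE)
    then show ?thesis using fin by (simp add: sum.inter_filter)
  qed
  have st0: "is_stationary V E w0"
    unfolding is_stationary_def
  proof (intro conjI ballI allI impI)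
    fix k assume k: "k \<in> V"
    have "(\<Sum>j\<in>{j\<in>V. E k j}. w0 j / ?d j) = (\<Sum>j\<in>{j\<in>V. E k j}. 1 / ?D)"
      using dpos by (intro sum.cong refl) (force simp: w0_def)
    also have "\<dots> = w0 k" using k by (simp add: w0_def deg_def)
    finally show "w0 k = (\<Sum>j\<in>V. w0 j * trans_prob V E j k)" by (simp add: flow)
    show "w0 k \<ge> 0" using Dpos by (simp add: w0_def)
  next
    show "sum w0 V = 1" using Dpos by (simp add: w0_def flip: sum_divide_distrib)
  qed (simp add: w0_def)
  have uniq: "w = w0" if "is_stationary V E w" for w
  proof -
    note st = that[unfolded is_stationary_def]
    define u where "u k = w k / ?d k" for k
    have harm: "(\<Sum>j\<in>{j\<in>V. E k j}. u j) = (\<Sum>j\<in>{j\<in>V. E k j}. u k)" if "k \<in> V" for k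
    proof -
      have "w k = (\<Sum>j\<in>V. w j * trans_prob V E j k)" using st that by blast
      then have "w k = (\<Sum>j\<in>{j\<in>V. E k j}. u j)" by (simp add: flow u_def)
      then show ?thesis using dpos[OF that] by (simp add: u_def deg_def field_simps)
    qed
    obtain z where z: "z \<in> V" "\<And>y. y \<in> V \<Longrightarrow> u y \<le> u z"
    proof -
      have "Max (u ` V) \<in> u ` V" using fin x by (intro Max_in) auto
      then obtain z where "z \<in> V" "u z = Max (u ` V)" by auto
      then show thesis using that[of z] fin by simp
    qed
    have const: "y \<in> {y\<in>V. u y = u z}" if "y \<in> V" for y
    proof (rule connected_closed_subset[OF con _ z(1) that])
      fix a b assume a: "a \<in> {y\<in>V. u y = u z}" and ab: "E a b"
      have b: "b \<in> {j\<in>V. E a j}" using ab sg by (auto simp: simple_graph_def)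
      have "(\<Sum>j\<in>{j\<in>V. E a j}. u z - u j) = 0"
        using harm[of a] a by (simp add: sum_subtractf)
      then have "u z - u b = 0"
        using b z(2) fin by (subst (asm) sum_nonneg_eq_0_iff) auto
      then show "b \<in> {y\<in>V. u y = u z}" using b by simp
    qed (use z in simp)
    have wk: "w k = u z * ?d k" if "k \<in> V" for k
      using const[OF that] dpos[OF that] by (simp add: u_def field_simps)
    have "sum w V = 1" using st by blast
    moreover have "sum w V = (\<Sum>k\<in>V. u z * ?d k)" using wk by (rule sum.cong[OF refl])
    ultimately have "1 = (\<Sum>k\<in>V. u z * ?d k)" by simp
    then have "u z = 1 / ?D" using Dpos by (simp add: sum_distrib_left[symmetric] field_simps)
    moreover have "w k = 0" if "k \<notin> V" for k using st that by blast
    ultimately have "w k = w0 k" for k using wk[of k] by (cases "k \<in> V") (simp_all add: w0_def)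
    then show "w = w0" by blast
  qed
  have "stat_dist V E = w0" unfolding stat_dist_def by (rule the_equality) (fact st0, rule uniq)
  then show ?thesis using x by (simp add: w0_def)
qed

text \<open>\<open>R\<close> plays the role of effective resistance: the hypothesis \<open>lap\<close> is all of its theory
  that is needed, and \<open>h j = 1/2 * (\<Sum>v. deg v * (R j k + R v k - R j v))\<close> is then the mean
  first passage time from \<open>j\<close> to \<open>k\<close>.\<close>

lemma kemeny_resistance:
  fixes R :: "'a \<Rightarrow> 'a \<Rightarrow> real"
  assumes sg: "simple_graph V E" and con: "connected_graph V E" and n2: "card V \<ge> 2"
    and R0: "\<And>x. R x x = 0" and Rsym: "\<And>x y. x \<in> V \<Longrightarrow> y \<in> V \<Longrightarrow> R x y = R y x"
    and lap: "\<And>j k. j \<in> V \<Longrightarrow> k \<in> V \<Longrightarrow>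
       (\<Sum>l\<in>{l\<in>V. E j l}. R j k - R l k) = \<kappa> j - (if j = k then 2 else 0)"
  shows "kemeny V E = (\<Sum>x\<in>V. \<Sum>y\<in>V. real (deg V E x) * real (deg V E y) * R x y) / (2 * (\<Sum>x\<in>V. real (deg V E x)))"
proof -
  have fin: "finite V" using sg by (simp add: simple_graph_def)
  let ?d = "\<lambda>x. real (deg V E x)"
  let ?D = "\<Sum>k\<in>V. ?d k"
  let ?N = "\<lambda>j. {l\<in>V. E j l}"
  have Vne: "V \<noteq> {}" using n2 by auto
  define j where "j = (SOME j. j \<in> V)"
  have j: "j \<in> V" unfolding j_def using Vne by (meson ex_in_conv someI_ex)
  have dpos: "?d x > 0" if "x \<in> V" for x using deg_pos[OF sg con n2 that] by simp
  have row: "(\<Sum>l\<in>V. trans_prob V E x l) = 1" if "x \<in> V" for x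
    using sum_trans_prob[OF fin, of E x "\<lambda>_. 1"] dpos[OF that] by (simp add: deg_def)
  define h where "h k x = 1/2 * (\<Sum>v\<in>V. ?d v * (R x k + R v k - R x v))" for k x
  have hk: "h k k = 0" if "k \<in> V" for k
    using that Rsym by (simp add: h_def R0)
  have hrec: "h k x = 1 + (\<Sum>l\<in>V. trans_prob V E x l * h k l)" if x: "x \<in> V" and k: "k \<in> V" and xk: "x \<noteq> k" for x k
  proof -
    have "(\<Sum>l\<in>?N x. h k x - h k l) =
        (\<Sum>l\<in>?N x. 1/2 * (\<Sum>v\<in>V. ?d v * ((R x k - R l k) - (R x v - R l v))))"
      by (intro sum.cong refl) (simp add: h_def algebra_simps sum_subtractf sum.distrib)
    also have "\<dots> = 1/2 * (\<Sum>v\<in>V. \<Sum>l\<in>?N x. ?d v * ((R x k - R l k) - (R x v - R l v)))"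
      by (subst sum.swap) (simp add: sum_distrib_left)
    also have "\<dots> = 1/2 * (\<Sum>v\<in>V. ?d v * ((\<Sum>l\<in>?N x. R x k - R l k) - (\<Sum>l\<in>?N x. R x v - R l v)))"
      by (subst sum_subtractf[symmetric]) (simp add: sum_distrib_left)
    \<comment> \<open>Both inner sums are Laplacians at \<open>x\<close>, so
      \<open>\<kappa> x\<close> cancels. As \<open>x \<noteq> k\<close>, only the correction at
      \<open>v = x\<close> is left.\<close>
    also have "\<dots> = 1/2 * (\<Sum>v\<in>V. if v = x then 2 * ?d v else 0)"
      using x k xk by (intro arg_cong[where f = "\<lambda>t. 1/2 * t"] sum.cong) (auto simp: lap)
    also have "\<dots> = ?d x" using x fin by simp
    finally have "?d x * h k x - (\<Sum>l\<in>?N x. h k l) = ?d x"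
      by (simp add: sum_subtractf deg_def)
    then show ?thesis unfolding sum_trans_prob[OF fin] using dpos[OF x] by (simp add: field_simps)
  qed
  have "kemeny V E = (\<Sum>k\<in>V - {j}. h k j * (?d k / ?D))"
    unfolding kemeny_def j_def[symmetric] Let_def
    using first_passage_mean[OF fin _ row hk hrec j] stat_dist_eq[OF sg con n2]
    by (intro sum.cong) auto
  also have "\<dots> = (\<Sum>k\<in>V. h k j * (?d k / ?D))"
    using j fin hk[OF j] by (simp add: sum.remove[of V j])
  also have "\<dots> = (\<Sum>k\<in>V. \<Sum>v\<in>V. ?d k * ?d v * (R j k + R v k - R j v)) / (2 * ?D)"
    by (simp add: h_def sum_divide_distrib sum_distrib_left sum_distrib_right field_simps)
  also have "(\<Sum>k\<in>V. \<Sum>v\<in>V. ?d k * ?d v * (R j k + R v k - R j v)) =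
     (\<Sum>k\<in>V. \<Sum>v\<in>V. ?d k * ?d v * R j k) + (\<Sum>k\<in>V. \<Sum>v\<in>V. ?d k * ?d v * R v k)
     - (\<Sum>k\<in>V. \<Sum>v\<in>V. ?d k * ?d v * R j v)"
    by (simp add: algebra_simps sum.distrib sum_subtractf)
  \<comment> \<open>Exchanging the two summation variables makes the sums that contain
    \<open>j\<close> cancel; this is the independence of the starting vertex.\<close>
  also have "(\<Sum>k\<in>V. \<Sum>v\<in>V. ?d k * ?d v * R j v) = (\<Sum>k\<in>V. \<Sum>v\<in>V. ?d k * ?d v * R j k)"
    by (subst sum.swap) (simp add: mult.commute)
  also have "(\<Sum>k\<in>V. \<Sum>v\<in>V. ?d k * ?d v * R v k) = (\<Sum>k\<in>V. \<Sum>v\<in>V. ?d k * ?d v * R k v)"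
    by (intro sum.cong refl) (simp add: Rsym)
  finally show ?thesis by simp
qed

section \<open>Distances in trees\<close>

lemma is_path_successively: "is_path E p \<longleftrightarrow> distinct p \<and> successively E p"
  by (simp add: is_path_def successively_conv_nth)

lemma is_path_Nil [simp]: "is_path E []"
  by (simp add: is_path_def)

lemma is_path_Cons: "is_path E (x # p) \<longleftrightarrow> x \<notin> set p \<and> is_path E p \<and> (p \<noteq> [] \<longrightarrow> E x (hd p))"
  by (auto simp: is_path_successively successively_Cons)

lemma is_path_append:
  "is_path E (p @ q) \<longleftrightarrow> is_path E p \<and> is_path E q \<and> set p \<inter> set q = {} \<and>
     (p \<noteq> [] \<longrightarrow> q \<noteq> [] \<longrightarrow> E (last p) (hd q))"
  by (auto simp: is_path_successively successively_append_iff)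

lemma is_path_rev:
  assumes "\<And>x y. E x y \<Longrightarrow> E y x"
  shows "is_path E (rev p) \<longleftrightarrow> is_path E p"
proof -
  have "(\<lambda>x y. E y x) = E" using assms by blast
  then have "successively (\<lambda>x y. E y x) p = successively E p" by (rule arg_cong)
  then show ?thesis by (simp add: is_path_successively)
qed

text \<open>If the paths leave \<open>x\<close> by different edges, they still meet again, at the
  latest in their common last vertex. The first vertex \<open>z\<close> of one that lies on the
  other closes a cycle through \<open>x\<close>; it has at least three vertices because the two
  second vertices differ.\<close>

lemma acyclic_path_unique:
  assumes sym: "\<And>x y. E x y \<Longrightarrow> E y x" and acyc: "\<not> has_cycle E"
    and "is_path E p" "is_path E q" "p \<noteq> []" "q \<noteq> []" "hd p = hd q" "last p = last q"
  shows "p = q"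
  using assms(3-)
proof (induction p arbitrary: q)
  case Nil then show ?case by simp
next
  case (Cons x p)
  obtain q' where q: "q = x # q'" using Cons.prems by (cases q) auto
  show ?case
  proof (cases "p = [] \<or> q' = []")
    case True
    then show ?thesis using Cons.prems q by (auto simp: is_path_Cons split: if_splits)
  next
    case False
    then have pq: "is_path E p" "is_path E q'" "p \<noteq> []" "q' \<noteq> []" "last p = last q'"
      "x \<notin> set p" "x \<notin> set q'" "E x (hd p)" "E x (hd q')"
      using Cons.prems q by (auto simp: is_path_Cons)
    have "hd p = hd q'"
    proof (rule ccontr)
      assume ne: "hd p \<noteq> hd q'"
      have "\<exists>z\<in>set p. z \<in> set q'" using pq by (metis last_in_set)
      then obtain p1 z p2 where p: "p = p1 @ z # p2" "z \<in> set q'" "\<forall>y\<in>set p1. y \<notin> set q'"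
        using split_list_first_prop[of p "\<lambda>y. y \<in> set q'"] by blast
      then obtain q1 q2 where q': "q' = q1 @ z # q2" by (meson split_list)
      let ?C = "x # p1 @ z # rev q1"
      have "is_path E (rev q1)" using pq(2) q' by (simp add: is_path_append is_path_rev[of E, OF sym])
      moreover have "q1 \<noteq> [] \<Longrightarrow> E z (hd (rev q1))"
        using pq(2) q' sym by (simp add: is_path_append hd_rev)
      ultimately have "is_path E ?C"
        using pq p q' by (auto simp: is_path_Cons is_path_append hd_append split: if_splits)
      moreover have "E (last ?C) (hd ?C)"
        using pq q' sym by (cases q1) (auto simp: last_rev)
      moreover have "length ?C \<ge> 3" using ne p q' by (cases p1; cases q1) auto
      ultimately show False using acyc unfolding has_cycle_def by blast
    qed
    then show ?thesis using Cons.IH[of q'] pq q by simp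
  qed
qed

section \<open>The metric of a tree and its Laplacian\<close>

locale tree_graph =
  fixes V :: "'a set" and E :: "'a \<Rightarrow> 'a \<Rightarrow> bool"
  assumes tree: "is_tree V E"
begin

lemma sg: "simple_graph V E" and con: "connected_graph V E" and acyc: "\<not> has_cycle E"
  using tree by (auto simp: is_tree_def)

lemma fin: "finite V"
  using sg by (simp add: simple_graph_def)

lemma symE: "E x y \<Longrightarrow> E y x"
  using sg by (auto simp: simple_graph_def)

lemma edgeD: "E x y \<Longrightarrow> x \<in> V" "E x y \<Longrightarrow> y \<in> V" "E x y \<Longrightarrow> x \<noteq> y"
  using sg by (auto simp: simple_graph_def)

definition tpath :: "'a \<Rightarrow> 'a \<Rightarrow> 'a list" where
  "tpath x y = (THE p. is_path E p \<and> p \<noteq> [] \<and> hd p = x \<and> last p = y)"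

definition tdist :: "'a \<Rightarrow> 'a \<Rightarrow> nat" where
  "tdist x y = length (tpath x y) - 1"

abbreviation nbrs :: "'a \<Rightarrow> 'a set" where
  "nbrs x \<equiv> {y\<in>V. E x y}"

lemma tpath_eq:
  assumes "is_path E p" "p \<noteq> []"
  shows "tpath (hd p) (last p) = p"
  unfolding tpath_def using assms acyclic_path_unique[OF symE acyc]
  by (intro the_equality) auto

lemma tpath:
  assumes "x \<in> V" "y \<in> V"
  shows "is_path E (tpath x y)" "tpath x y \<noteq> []" "hd (tpath x y) = x" "last (tpath x y) = y"
  using con assms tpath_eq unfolding connected_graph_def by metis+

lemma tdist_path:
  assumes "is_path E p" "p \<noteq> []"
  shows "tdist (hd p) (last p) = length p - 1"
  by (simp add: tdist_def tpath_eq assms)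

lemma tdist_self [simp]: "tdist x x = 0"
  using tdist_path[of "[x]"] by (simp add: is_path_Cons)

lemma tdist_edge: "E x y \<Longrightarrow> tdist x y = 1"
  using tdist_path[of "[x, y]"] edgeD by (auto simp: is_path_Cons)

lemma tdist_commute:
  assumes "x \<in> V" "y \<in> V"
  shows "tdist x y = tdist y x"
proof -
  note p = tpath[OF assms]
  have "is_path E (rev (tpath x y))" using p by (simp add: is_path_rev[of E, OF symE])
  from tdist_path[OF this] p show ?thesis by (simp add: hd_rev last_rev tdist_def)
qed

text \<open>Removing \<open>x\<close> from its path to \<open>y\<close> exhibits the closer
  neighbour. Any other neighbour \<open>l\<close> is off that path, since otherwise the edge and a
  segment of the path would be two paths from \<open>x\<close> to \<open>l\<close>; hence putting
  \<open>l\<close> in front gives the path from \<open>l\<close> to \<open>y\<close>.\<close>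

lemma tdist_step:
  assumes "x \<in> V" "y \<in> V" "x \<noteq> y"
  obtains z where "E x z" "tdist x y = Suc (tdist z y)"
    "\<And>l. E x l \<Longrightarrow> l \<noteq> z \<Longrightarrow> tdist l y = Suc (tdist x y)"
proof -
  note p = tpath[OF assms(1,2)]
  obtain q where q: "tpath x y = x # q" using p(2,3) by (cases "tpath x y") auto
  have qn: "q \<noteq> []" using p(4) q assms(3) by auto
  have qp: "is_path E q" "x \<notin> set q" "E x (hd q)" "last q = y" using p q qn by (auto simp: is_path_Cons)
  have dq: "tdist (hd q) y = length q - 1" using tdist_path[OF qp(1) qn] qp by simp
  have dx: "tdist x y = length q" by (simp add: tdist_def q)
  have other: "tdist l y = Suc (tdist x y)" if "E x l" "l \<noteq> hd q" for l
  proof -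
    have "l \<notin> set q"
    proof
      assume "l \<in> set q"
      then obtain q1 q2 where q12: "q = q1 @ l # q2" by (meson split_list)
      have "is_path E (x # q1 @ [l])"
        using qp q12 by (auto simp: is_path_append is_path_Cons hd_append split: if_splits)
      moreover have "is_path E [x, l]" using that edgeD by (auto simp: is_path_Cons)
      ultimately have "x # q1 @ [l] = [x, l]"
        by (intro acyclic_path_unique[OF symE acyc]) auto
      then show False using q12 that by simp
    qed
    then have "is_path E (l # x # q)" using p(1) q symE[OF that(1)] edgeD(3)[OF that(1)]
      by (auto simp: is_path_Cons)
    from tdist_path[OF this] show ?thesis using qp qn dx by simp
  qed
  show thesis using that[of "hd q"] qp(3) dx dq qn other by (simp add: Suc_pred')
qed

definition nxt :: "'a \<Rightarrow> 'a \<Rightarrow> 'a" where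
  "nxt y x = (SOME z. E x z \<and> tdist x y = Suc (tdist z y) \<and>
     (\<forall>l. E x l \<longrightarrow> l \<noteq> z \<longrightarrow> tdist l y = Suc (tdist x y)))"

lemma nxt:
  assumes "x \<in> V" "y \<in> V" "x \<noteq> y"
  shows "E x (nxt y x)" "tdist x y = Suc (tdist (nxt y x) y)"
    "\<And>l. E x l \<Longrightarrow> l \<noteq> nxt y x \<Longrightarrow> tdist l y = Suc (tdist x y)"
proof -
  let ?Q = "\<lambda>z. E x z \<and> tdist x y = Suc (tdist z y) \<and>
     (\<forall>l. E x l \<longrightarrow> l \<noteq> z \<longrightarrow> tdist l y = Suc (tdist x y))"
  have "\<exists>z. ?Q z" using tdist_step[OF assms] by metis
  then have "?Q (nxt y x)" unfolding nxt_def by (rule someI_ex)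
  then show "E x (nxt y x)" "tdist x y = Suc (tdist (nxt y x) y)"
    "\<And>l. E x l \<Longrightarrow> l \<noteq> nxt y x \<Longrightarrow> tdist l y = Suc (tdist x y)" by auto
qed

lemma nxt_unique:
  assumes "x \<in> V" "y \<in> V" "E x z" "tdist z y < tdist x y"
  shows "z = nxt y x"
  using nxt(3)[OF assms(1,2), of z] assms by force

lemma tdist_eq_0: "x \<in> V \<Longrightarrow> y \<in> V \<Longrightarrow> tdist x y = 0 \<longleftrightarrow> x = y"
  using nxt(2)[of x y] by (cases "x = y") auto

lemma tdist_edge_cases:
  assumes "E x z" "y \<in> V"
  shows "tdist x y = Suc (tdist z y) \<or> tdist z y = Suc (tdist x y)"
proof (cases "x = y")
  case True then show ?thesis using tdist_edge[OF symE[OF assms(1)]] by simp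
next
  case False
  show ?thesis using nxt[OF edgeD(1)[OF assms(1)] assms(2) False] assms(1) by metis
qed

lemma tdist_triangle:
  assumes "x \<in> V" "y \<in> V" "z \<in> V"
  shows "tdist x z \<le> tdist x y + tdist y z"
  using assms
proof (induction "tdist x y" arbitrary: x)
  case 0 then show ?case by (simp add: tdist_eq_0)
next
  case (Suc m)
  then have ne: "x \<noteq> y" by auto
  note w = nxt[OF Suc.prems(1,2) ne]
  have "tdist (nxt y x) z \<le> tdist (nxt y x) y + tdist y z"
    using Suc w edgeD[OF w(1)] by (intro Suc.hyps) auto
  then show ?case using tdist_edge_cases[OF w(1) Suc.prems(3)] w(2) by auto
qed

lemma tdist_1_iff: "x \<in> V \<Longrightarrow> y \<in> V \<Longrightarrow> tdist x y = 1 \<longleftrightarrow> E x y"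
  using tdist_edge nxt(1,2)[of x y] tdist_eq_0[of "nxt y x" y] edgeD(2)
  by (metis One_nat_def nat.inject tdist_self zero_neq_one)

text \<open>One neighbour of \<open>j\<close> is closer to \<open>k\<close> and
  \<open>deg j - 1\<close> are farther, which gives \<open>2 - deg j\<close>. For
  \<open>j = k\<close> all are farther, whence the correction by 2.\<close>

lemma tdist_laplacian:
  assumes "j \<in> V" "k \<in> V"
  shows "(\<Sum>l\<in>{l\<in>V. E j l}. real (tdist j k) - real (tdist l k)) = (2 - real (deg V E j)) - (if j = k then 2 else 0)"
proof (cases "j = k")
  case True
  have "(\<Sum>l\<in>nbrs j. real (tdist j k) - real (tdist l k)) = (\<Sum>l\<in>nbrs j. -1)"
    using True tdist_edge symE by (intro sum.cong) auto
  then show ?thesis using True by (simp add: deg_def)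
next
  case False
  note w = nxt[OF assms False]
  have "(\<Sum>l\<in>nbrs j. real (tdist j k) - real (tdist l k)) =
        (\<Sum>l\<in>nbrs j. (if l = nxt k j then 2 else 0) - 1)"
    using w by (intro sum.cong) auto
  also have "\<dots> = 2 - real (deg V E j)"
    using w(1) edgeD fin by (auto simp: sum_subtractf deg_def)
  finally show ?thesis using False by simp
qed

text \<open>Orient every edge towards the root \<open>r\<close>; each vertex other than \<open>r\<close> then owns one edge.\<close>

lemma sum_deg:
  fixes f :: "'a \<Rightarrow> real"
  assumes r: "r \<in> V"
  shows "(\<Sum>j\<in>V. deg V E j * f j) = (\<Sum>x\<in>V - {r}. f x + f (nxt r x))"
proof -
  let ?U = "(\<lambda>x. (x, nxt r x)) ` (V - {r})" and ?W = "(\<lambda>x. (nxt r x, x)) ` (V - {r})"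
  note n = nxt[OF _ r]
  have dlt: "tdist (nxt r x) r < tdist x r" if "x \<in> V - {r}" for x using n(2)[of x] that by auto
  have eq: "(SIGMA j:V. nbrs j) = ?U \<union> ?W"
  proof (intro equalityI subsetI)
    fix e assume "e \<in> (SIGMA j:V. nbrs j)"
    then obtain j l where e: "e = (j, l)" "E j l" "j \<in> V" "l \<in> V" by auto
    from tdist_edge_cases[OF e(2) r]
    show "e \<in> ?U \<union> ?W"
    proof
      assume *: "tdist j r = Suc (tdist l r)"
      then have "j \<noteq> r" by auto
      moreover have "l = nxt r j" using nxt_unique[OF e(3) r e(2)] * by simp
      ultimately show ?thesis using e by auto
    next
      assume *: "tdist l r = Suc (tdist j r)"
      then have "l \<noteq> r" by auto
      moreover have "j = nxt r l" using nxt_unique[OF e(4) r symE[OF e(2)]] * by simp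
      ultimately show ?thesis using e by auto
    qed
  next
    fix e assume "e \<in> ?U \<union> ?W"
    then obtain x where x: "x \<in> V" "x \<noteq> r" "e = (x, nxt r x) \<or> e = (nxt r x, x)" by auto
    note ex = n(1)[OF x(1,2)]
    show "e \<in> (SIGMA j:V. nbrs j)" using x(3) ex symE[OF ex] edgeD(1,2)[OF ex] by (elim disjE) simp_all
  qed
  have disj: "?U \<inter> ?W = {}"
  proof (rule equals0I)
    fix e assume "e \<in> ?U \<inter> ?W"
    then have "e \<in> ?U" "e \<in> ?W" by blast+
    then obtain x y where x: "x \<in> V - {r}" "e = (x, nxt r x)" and y: "y \<in> V - {r}" "e = (nxt r y, y)"
      by (elim imageE)
    then have "x = fst e" "nxt r x = snd e" "y = snd e" "nxt r y = fst e" by (metis fst_conv snd_conv)+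
    then have "tdist (snd e) r < tdist (fst e) r" "tdist (fst e) r < tdist (snd e) r"
      using dlt[OF x(1)] dlt[OF y(1)] by (simp_all only:)
    then show False by simp
  qed
  have "(\<Sum>j\<in>V. deg V E j * f j) = (\<Sum>j\<in>V. \<Sum>l\<in>nbrs j. f j)" by (simp add: deg_def)
  also have "\<dots> = (\<Sum>(j,l)\<in>(SIGMA j:V. nbrs j). f j)" using fin by (intro sum.Sigma) auto
  also have "\<dots> = (\<Sum>(j,l)\<in>?U. f j) + (\<Sum>(j,l)\<in>?W. f j)"
    unfolding eq using fin disj by (intro sum.union_disjoint) auto
  also have "(\<Sum>(j,l)\<in>?U. f j) = (\<Sum>x\<in>V - {r}. f x)"
    by (subst sum.reindex) (auto simp: inj_on_def)
  also have "(\<Sum>(j,l)\<in>?W. f j) = (\<Sum>x\<in>V - {r}. f (nxt r x))"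
    by (subst sum.reindex) (auto simp: inj_on_def)
  finally show ?thesis by (simp add: sum.distrib)
qed

lemma sum_deg_1: "(\<Sum>j\<in>V. real (deg V E j)) = 2 * (real (card V) - 1)"
proof -
  obtain r where r: "r \<in> V" using tree by (auto simp: is_tree_def)
  then have "card V \<ge> 1" using fin card_gt_0_iff[of V] by fastforce
  then show ?thesis using sum_deg[OF r, of "\<lambda>_. 1"] r fin by (simp add: of_nat_diff)
qed

text \<open>The edge owned by \<open>x\<close> joins distances \<open>tdist x r\<close> and
  \<open>tdist x r - 1\<close>, so it contributes \<open>2 * tdist x r - 1\<close>.\<close>

lemma sum_deg_tdist:
  assumes r: "r \<in> V"
  shows "(\<Sum>j\<in>V. deg V E j * real (tdist j r)) = 2 * (\<Sum>j\<in>V. real (tdist j r)) - (real (card V) - 1)"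
proof -
  have "card V \<ge> 1" using fin r card_gt_0_iff[of V] by fastforce
  have "(\<Sum>j\<in>V. deg V E j * real (tdist j r)) = (\<Sum>x\<in>V - {r}. 2 * real (tdist x r) - 1)"
    unfolding sum_deg[OF r] using nxt(2)[OF _ r] by (intro sum.cong) force+
  also have "\<dots> = 2 * (\<Sum>x\<in>V - {r}. real (tdist x r)) - (real (card V) - 1)"
    using r fin \<open>card V \<ge> 1\<close> by (simp add: sum_subtractf sum_distrib_left of_nat_diff)
  also have "(\<Sum>x\<in>V - {r}. real (tdist x r)) = (\<Sum>x\<in>V. real (tdist x r))"
    using r fin by (simp add: sum.remove[of V r])
  finally show ?thesis .
qed

text \<open>\<open>sum_deg_tdist\<close> is applied in one variable and then in the other. This is
  the classical relation between the Gutman index and the Wiener index of a tree.\<close>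

lemma sum_deg_deg_tdist:
  "(\<Sum>x\<in>V. \<Sum>y\<in>V. real (deg V E x) * real (deg V E y) * real (tdist x y)) =
     4 * (\<Sum>x\<in>V. \<Sum>y\<in>V. real (tdist x y)) - 2 * (real (card V) - 1) * (2 * real (card V) - 1)"
proof -
  let ?d = "\<lambda>x. real (deg V E x)" and ?n = "real (card V)"
  have s: "(\<Sum>y\<in>V. ?d y * real (tdist x y)) = 2 * (\<Sum>y\<in>V. real (tdist x y)) - (?n - 1)" if "x \<in> V" for x
  proof -
    have "(\<Sum>y\<in>V. f y * real (tdist x y)) = (\<Sum>y\<in>V. f y * real (tdist y x))" for f
      using tdist_commute[OF that] by (intro sum.cong) simp_all
    from this[of ?d] this[of "\<lambda>_. 1"] show ?thesis using sum_deg_tdist[OF that] by simp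
  qed
  have "(\<Sum>x\<in>V. \<Sum>y\<in>V. ?d x * ?d y * real (tdist x y)) = (\<Sum>x\<in>V. ?d x * (\<Sum>y\<in>V. ?d y * real (tdist x y)))"
    by (simp add: sum_distrib_left mult.assoc)
  also have "\<dots> = (\<Sum>x\<in>V. ?d x * (2 * (\<Sum>y\<in>V. real (tdist x y)) - (?n - 1)))"
    by (intro sum.cong refl) (simp add: s)
  also have "\<dots> = 2 * (\<Sum>x\<in>V. \<Sum>y\<in>V. ?d x * real (tdist x y)) - (?n - 1) * (\<Sum>x\<in>V. ?d x)"
    by (simp add: right_diff_distrib sum_subtractf sum_distrib_left mult_ac)
  also have "(\<Sum>x\<in>V. \<Sum>y\<in>V. ?d x * real (tdist x y)) = (\<Sum>y\<in>V. 2 * (\<Sum>x\<in>V. real (tdist x y)) - (?n - 1))"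
    by (subst sum.swap) (simp add: sum_deg_tdist)
  also have "\<dots> = 2 * (\<Sum>x\<in>V. \<Sum>y\<in>V. real (tdist x y)) - ?n * (?n - 1)"
    by (subst sum.swap) (simp add: sum_subtractf sum_distrib_left)
  finally show ?thesis by (simp add: sum_deg_1 algebra_simps)
qed

lemma kemeny_tree:
  assumes "card V \<ge> 2"
  shows "kemeny V E = (4 * (\<Sum>x\<in>V. \<Sum>y\<in>V. real (tdist x y)) - 2 * (real (card V) - 1) * (2 * real (card V) - 1))
     / (4 * (real (card V) - 1))"
proof -
  have "kemeny V E = (\<Sum>x\<in>V. \<Sum>y\<in>V. real (deg V E x) * real (deg V E y) * real (tdist x y)) / (2 * (\<Sum>x\<in>V. real (deg V E x)))"
  proof (rule kemeny_resistance[OF sg con assms])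
    show "(\<Sum>l\<in>{l\<in>V. E j l}. real (tdist j k) - real (tdist l k)) = (2 - real (deg V E j)) - (if j = k then 2 else 0)"
      if "j \<in> V" "k \<in> V" for j k using that by (rule tdist_laplacian)
    show "real (tdist x y) = real (tdist y x)" if "x \<in> V" "y \<in> V" for x y
      using tdist_commute[OF that] by simp
  qed simp
  then show ?thesis unfolding sum_deg_deg_tdist sum_deg_1 by simp
qed

end

section \<open>Adding an edge between the ends of a path\<close>

locale tree_with_path = tree_graph +
  fixes vs :: "'a list"
  assumes path: "is_path E vs" and len: "3 \<le> length vs" and nonadj: "\<not> E (hd vs) (last vs)"
begin

abbreviation c :: nat where "c \<equiv> length vs"
abbreviation n :: nat where "n \<equiv> card V"

lemma vs_in_V: "s < c \<Longrightarrow> vs ! s \<in> V"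
proof -
  assume s: "s < c"
  have "E (vs ! s) (vs ! Suc s) \<or> E (vs ! (s - 1)) (vs ! s)"
  proof (cases "Suc s < c")
    case False
    then have "Suc (s - 1) < c" "s = Suc (s - 1)" using len s by linarith+
    then show ?thesis using path unfolding is_path_def by metis
  qed (use path in \<open>simp add: is_path_def\<close>)
  then show ?thesis using edgeD by auto
qed

lemma distinct_vs: "distinct vs"
  using path by (simp add: is_path_def)

lemma set_vs: "set vs \<subseteq> V"
  using vs_in_V by (auto simp: in_set_conv_nth)

lemma c_le_n: "c \<le> n"
  using card_mono[OF fin set_vs] distinct_card[OF distinct_vs] by simp

lemma vs_nonempty: "vs \<noteq> []"
  using len by auto

lemma hd_vs: "hd vs = vs ! 0" and last_vs: "last vs = vs ! (c - 1)"
  by (rule hd_conv_nth, rule vs_nonempty, rule last_conv_nth, rule vs_nonempty)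

text \<open>Once the distance to \<open>x\<close> has gone up along a path, it keeps going up, because the
  predecessor on the path is the only neighbour closer to \<open>x\<close>.\<close>

lemma tdist_ascending:
  assumes "is_path E ws" "x \<in> V" "\<And>s. s < length ws \<Longrightarrow> ws ! s \<in> V"
    and min: "\<And>s. s < length ws \<Longrightarrow> tdist (ws ! 0) x \<le> tdist (ws ! s) x"
    and s: "s < length ws"
  shows "tdist (ws ! s) x = tdist (ws ! 0) x + s"
proof -
  have adj: "E (ws ! i) (ws ! Suc i)" if "Suc i < length ws" for i
    using assms(1) that by (simp add: is_path_def)
  have "Suc s < length ws \<longrightarrow> tdist (ws ! Suc s) x = Suc (tdist (ws ! s) x)"
    if "s < length ws" for s
    using that
  proof (induction s)
    case 0
    then show ?case using adj[of 0] tdist_edge_cases[OF _ assms(2), of "ws ! 0" "ws ! 1"] min[of 1] by auto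
  next
    case (Suc s)
    show ?case
    proof
      assume S: "Suc (Suc s) < length ws"
      have up: "tdist (ws ! Suc s) x = Suc (tdist (ws ! s) x)" using Suc by simp
      then have ne: "ws ! Suc s \<noteq> x" by auto
      have "ws ! s = nxt x (ws ! Suc s)"
        using S up symE[OF adj[of s]] by (intro nxt_unique assms(2,3)) auto
      moreover have "ws ! s \<noteq> ws ! Suc (Suc s)"
        using assms(1) S by (simp add: is_path_def nth_eq_iff_index_eq)
      ultimately show "tdist (ws ! Suc (Suc s)) x = Suc (tdist (ws ! Suc s) x)"
        using nxt(3)[OF _ assms(2) ne, of "ws ! Suc (Suc s)"] adj[of "Suc s"] S assms(3)[of "Suc s"] by auto
    qed
  qed
  note step = this
  show ?thesis using s
  proof (induction s)
    case (Suc s) then show ?case using step[of s] by simp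
  qed simp
qed

text \<open>Take a path vertex nearest to \<open>x\<close>. The two halves of the path that start
  there both satisfy the hypotheses of \<open>tdist_ascending\<close>.\<close>

lemma projection:
  assumes x: "x \<in> V"
  shows "\<exists>t. t < c \<and> (\<exists>h::nat. \<forall>s<c. real (tdist (vs ! s) x) = real h + \<bar>real s - real t\<bar>)"
proof -
  have "Min ((\<lambda>s. tdist (vs ! s) x) ` {..<c}) \<in> (\<lambda>s. tdist (vs ! s) x) ` {..<c}"
    using len by (intro Min_in) (auto simp: lessThan_empty_iff)
  then obtain t where t: "t < c" "Min ((\<lambda>s. tdist (vs ! s) x) ` {..<c}) = tdist (vs ! t) x" by auto
  have min: "tdist (vs ! t) x \<le> tdist (vs ! s) x" if "s < c" for s
    using that t(2)[symmetric] by simp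
  have vsplit: "vs = take t vs @ drop t vs" "vs = take (Suc t) vs @ drop (Suc t) vs" by simp_all
  have up: "tdist (vs ! s) x = tdist (vs ! t) x + (s - t)" if "t \<le> s" "s < c" for s
  proof -
    have "is_path E (drop t vs)" using path vsplit(1) by (metis is_path_append)
    from tdist_ascending[OF this x, of "s - t"] show ?thesis
      using that t vs_in_V min by simp
  qed
  have down: "tdist (vs ! s) x = tdist (vs ! t) x + (t - s)" if "s \<le> t" for s
  proof -
    let ?ws = "rev (take (Suc t) vs)"
    have "is_path E (take (Suc t) vs)" using path vsplit(2) by (metis is_path_append)
    then have "is_path E ?ws" using is_path_rev[of E, OF symE] by blast
    moreover have "?ws ! i = vs ! (t - i)" if "i \<le> t" for i using t that by (simp add: rev_nth)
    ultimately show ?thesis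
      using tdist_ascending[OF _ x, of ?ws "t - s"] that t vs_in_V min by simp
  qed
  have "real (tdist (vs ! s) x) = real (tdist (vs ! t) x) + \<bar>real s - real t\<bar>" if "s < c" for s
    using up[of s] down[of s] that by (cases "t \<le> s") (auto simp: of_nat_diff)
  with t(1) show ?thesis by blast
qed

text \<open>The position of the branch containing \<open>x\<close>; it is 0-based, so it is \<open>i - 1\<close> in the branch of \<open>v\<^sub>i\<close>.\<close>

definition pos :: "'a \<Rightarrow> nat" where
  "pos x = (SOME t. t < c \<and> (\<exists>h::nat. \<forall>s<c. real (tdist (vs ! s) x) = real h + \<bar>real s - real t\<bar>))"

definition ht :: "'a \<Rightarrow> nat" where
  "ht x = tdist (vs ! pos x) x"

lemma pos_less: "x \<in> V \<Longrightarrow> pos x < c"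
  and tdist_vs: "x \<in> V \<Longrightarrow> s < c \<Longrightarrow> real (tdist (vs ! s) x) = real (ht x) + \<bar>real s - real (pos x)\<bar>"
proof -
  assume x: "x \<in> V"
  have *: "pos x < c \<and> (\<exists>h::nat. \<forall>s<c. real (tdist (vs ! s) x) = real h + \<bar>real s - real (pos x)\<bar>)"
    unfolding pos_def using projection[OF x] by (rule someI_ex)
  then show "pos x < c" ..
  from * show "s < c \<Longrightarrow> real (tdist (vs ! s) x) = real (ht x) + \<bar>real s - real (pos x)\<bar>"
    unfolding ht_def by force
qed

text \<open>The distances from \<open>x\<close> to the two ends of the path are \<open>h + t\<close>
  and \<open>h + (c - 1 - t)\<close>; together they determine \<open>h\<close> and
  \<open>t\<close>.\<close>

lemma pos_ht_unique:
  assumes x: "x \<in> V" and t: "t < c" and h: "\<And>s. s < c \<Longrightarrow> real (tdist (vs ! s) x) = real h + \<bar>real s - real t\<bar>"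
  shows "pos x = t" "ht x = h"
proof -
  have "0 < c" "c - 1 < c" using len by auto
  then have "real h + real t = real (ht x) + real (pos x)"
    "real h + (real (c - 1) - real t) = real (ht x) + (real (c - 1) - real (pos x))"
    using h[of 0] tdist_vs[OF x, of 0] h[of "c - 1"] tdist_vs[OF x, of "c - 1"] pos_less[OF x] t by auto
  then have "real (pos x) = real t" "real (ht x) = real h" by linarith+
  then show "pos x = t" "ht x = h" by simp_all
qed

lemma ht_vs: "s < c \<Longrightarrow> ht (vs ! s) = 0" and pos_vs: "s < c \<Longrightarrow> pos (vs ! s) = s"
proof -
  assume s: "s < c"
  note v = vs_in_V[OF s]
  have "real (ht (vs ! s)) + \<bar>real s - real (pos (vs ! s))\<bar> = 0" using tdist_vs[OF v s] by simp
  then show "ht (vs ! s) = 0" "pos (vs ! s) = s" by linarith+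
qed

lemma ht_eq_0: "x \<in> V \<Longrightarrow> ht x = 0 \<longleftrightarrow> x \<in> set vs"
proof
  assume x: "x \<in> V" and "ht x = 0"
  then have "vs ! pos x = x" using tdist_eq_0[of "vs ! pos x" x] vs_in_V[OF pos_less[OF x]] by (simp add: ht_def)
  then show "x \<in> set vs" using pos_less[OF x] by (metis nth_mem)
qed (auto simp: in_set_conv_nth ht_vs)

lemma tdist_le:
  assumes x: "x \<in> V" and y: "y \<in> V"
  shows "real (tdist x y) \<le> real (ht x) + real (ht y) + \<bar>real (pos x) - real (pos y)\<bar>"
proof -
  let ?u = "vs ! pos x"
  have u: "?u \<in> V" using vs_in_V pos_less x by simp
  have "tdist x y \<le> tdist x ?u + tdist ?u y" by (rule tdist_triangle[OF x u y])
  moreover have "tdist x ?u = ht x" using tdist_commute[OF x u] by (simp add: ht_def)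
  ultimately show ?thesis using tdist_vs[OF y pos_less[OF x]] by simp
qed

text \<open>A step from \<open>x\<close> towards its own path vertex shortens the distance to every
  path vertex: the triangle inequality leaves no other option, as an edge changes distances by
  exactly 1. By uniqueness of the closer neighbour, this is the step towards any path vertex, and it
  stays in the branch.\<close>

lemma nxt_off_path:
  assumes x: "x \<in> V" "x \<notin> set vs" and s: "s < c"
  shows "ht (nxt (vs ! s) x) + 1 = ht x" "pos (nxt (vs ! s) x) = pos x"
proof -
  let ?u = "vs ! pos x"
  note px = pos_less[OF x(1)]
  have u: "?u \<in> V" using vs_in_V px by simp
  have ne: "x \<noteq> ?u" using x px by (metis nth_mem)
  let ?z = "nxt ?u x"
  note z = nxt[OF x(1) u ne]
  have zV: "?z \<in> V" using z(1) edgeD by blast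
  have du: "tdist ?u ?z + 1 = ht x" using z(2) by (simp add: ht_def tdist_commute u x zV)
  have dz: "real (tdist (vs ! r) ?z) = (real (ht x) - 1) + \<bar>real r - real (pos x)\<bar>" if r: "r < c" for r
  proof -
    note v = vs_in_V[OF r]
    have "real (tdist (vs ! r) ?u) = \<bar>real r - real (pos x)\<bar>"
      using tdist_vs[OF u r] px by (simp add: ht_vs pos_vs)
    then have "real (tdist (vs ! r) ?z) \<le> \<bar>real r - real (pos x)\<bar> + (real (ht x) - 1)"
      using tdist_triangle[OF v u zV] du by linarith
    moreover have "tdist x (vs ! r) = Suc (tdist ?z (vs ! r)) \<or> tdist ?z (vs ! r) = Suc (tdist x (vs ! r))"
      by (rule tdist_edge_cases[OF z(1) v])
    ultimately show ?thesis using tdist_vs[OF x(1) r] by (auto simp: tdist_commute v x zV)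
  qed
  have h: "real (ht x - 1) = real (ht x) - 1" using du by (simp add: of_nat_diff)
  have ph: "pos ?z = pos x" "ht ?z = ht x - 1"
    using pos_ht_unique[OF zV px, of "ht x - 1"] dz h by simp_all
  note v = vs_in_V[OF s]
  have "?z = nxt (vs ! s) x"
  proof (rule nxt_unique[OF x(1) v z(1)])
    have "real (tdist (vs ! s) ?z) < real (tdist (vs ! s) x)"
      using dz[OF s] tdist_vs[OF x(1) s] by simp
    then show "tdist ?z (vs ! s) < tdist x (vs ! s)" by (simp add: tdist_commute v x zV)
  qed
  then show "ht (nxt (vs ! s) x) + 1 = ht x" "pos (nxt (vs ! s) x) = pos x"
    using ph du by simp_all
qed

section \<open>Resistance in the graph with the added edge\<close>

abbreviation G :: "'a \<Rightarrow> 'a \<Rightarrow> bool" where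
  "G \<equiv> add_edge E (hd vs) (last vs)"

lemma ends: "hd vs \<in> V" "last vs \<in> V" "hd vs \<noteq> last vs" "\<not> E (last vs) (hd vs)"
  "pos (hd vs) = 0" "pos (last vs) = c - 1" "ht (hd vs) = 0" "ht (last vs) = 0"
proof -
  have l: "0 < c" "c - 1 < c" "0 \<noteq> c - 1" using len by auto
  show "hd vs \<in> V" "last vs \<in> V" unfolding hd_vs last_vs using l vs_in_V by blast+
  show "hd vs \<noteq> last vs" unfolding hd_vs last_vs using l distinct_vs by (metis nth_eq_iff_index_eq)
  show "\<not> E (last vs) (hd vs)" using nonadj symE by blast
  show "pos (hd vs) = 0" "pos (last vs) = c - 1" "ht (hd vs) = 0" "ht (last vs) = 0"
    unfolding hd_vs last_vs using l by (simp_all add: pos_vs ht_vs del: diff_is_0_eq')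
qed

lemma sg_G: "simple_graph V G"
  using sg ends by (auto simp: simple_graph_def add_edge_def)

lemma con_G: "connected_graph V G"
  unfolding connected_graph_def
proof (intro ballI)
  fix x y assume "x \<in> V" "y \<in> V"
  then obtain p where "is_path E p" "p \<noteq> []" "hd p = x" "last p = y"
    using con unfolding connected_graph_def by blast
  moreover from this have "is_path G p" by (simp add: is_path_def add_edge_def)
  ultimately show "\<exists>p. is_path G p \<and> p \<noteq> [] \<and> hd p = x \<and> last p = y" by blast
qed

definition ind :: "'a \<Rightarrow> 'a \<Rightarrow> real" where
  "ind a x = (if x = a then 1 else 0)"

lemma sum_ind: "a \<in> V \<Longrightarrow> (\<Sum>x\<in>V. ind a x * f x) = f a"
proof -
  assume "a \<in> V"
  have "(\<Sum>x\<in>V. ind a x * f x) = (\<Sum>x\<in>V. if x = a then f x else 0)"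
    by (intro sum.cong) (auto simp: ind_def)
  then show ?thesis using \<open>a \<in> V\<close> fin by simp
qed

lemma sum_nbrs_G:
  fixes f :: "'a \<Rightarrow> real"
  shows "(\<Sum>l\<in>{l\<in>V. G j l}. f l) =
    (\<Sum>l\<in>nbrs j. f l) + ind (hd vs) j * f (last vs) + ind (last vs) j * f (hd vs)"
proof -
  have N: "{l\<in>V. G j l} = nbrs j \<union> ((if j = hd vs then {last vs} else {}) \<union> (if j = last vs then {hd vs} else {}))"
    using ends by (auto simp: add_edge_def)
  show ?thesis unfolding N
    using ends nonadj fin by (subst sum.union_disjoint) (auto simp: ind_def)
qed

lemma deg_G: "real (deg V G x) = real (deg V E x) + ind (hd vs) x + ind (last vs) x"
  using sum_nbrs_G[of "\<lambda>_. 1" x] by (simp add: deg_def)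

lemma sum_deg_G:
  "(\<Sum>x\<in>V. real (deg V G x) * f x) = (\<Sum>x\<in>V. real (deg V E x) * f x) + f (hd vs) + f (last vs)"
  by (simp add: deg_G distrib_right sum.distrib sum_ind ends)

lemma sum_deg_G_1: "(\<Sum>x\<in>V. real (deg V G x)) = 2 * real n"
  using sum_deg_G[of "\<lambda>_. 1"] by (simp add: sum_deg_1)

lemma tdist_hd: "x \<in> V \<Longrightarrow> real (tdist x (hd vs)) = real (ht x) + real (pos x)"
  using tdist_vs[of x 0] vs_nonempty ends(1) by (simp add: hd_vs tdist_commute)

lemma tdist_last: "x \<in> V \<Longrightarrow> real (tdist x (last vs)) = real (ht x) + (real c - 1 - real (pos x))"
proof -
  assume x: "x \<in> V"
  have "real (c - 1) = real c - 1" "c - 1 < c" "pos x < c" using len pos_less[OF x] by (simp_all add: of_nat_diff)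
  then show ?thesis using tdist_vs[OF x, of "c - 1"] tdist_commute[OF x ends(2)] by (simp add: last_vs)
qed

text \<open>Up to the constant \<open>c - 1\<close>, \<open>2 * pos\<close> is the difference of the
  distances to the two ends, the heights cancelling. So \<open>pos\<close> is the potential of a
  unit current between the ends, constant on each branch.\<close>

lemma pos_laplacian:
  assumes "j \<in> V"
  shows "(\<Sum>l\<in>nbrs j. real (pos j) - real (pos l)) = ind (last vs) j - ind (hd vs) j"
proof -
  have "(\<Sum>l\<in>nbrs j. 2 * (real (pos j) - real (pos l))) =
    (\<Sum>l\<in>nbrs j. real (tdist j (hd vs)) - real (tdist l (hd vs))) -
    (\<Sum>l\<in>nbrs j. real (tdist j (last vs)) - real (tdist l (last vs)))"
    unfolding sum_subtractf[symmetric] using assms by (intro sum.cong) (auto simp: tdist_hd tdist_last)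
  also have "\<dots> = 2 * (ind (last vs) j - ind (hd vs) j)"
    using assms ends by (simp add: tdist_laplacian ind_def)
  finally show ?thesis unfolding sum_distrib_left[symmetric] by simp
qed

text \<open>Effective resistance of the unicyclic graph, by the Sherman--Morrison formula applied to
  the Laplacian of the tree.\<close>

definition res :: "'a \<Rightarrow> 'a \<Rightarrow> real" where
  "res x y = real (tdist x y) - (real (pos x) - real (pos y))\<^sup>2 / real c"

text \<open>Expanding the square leaves one term mixing \<open>k\<close> with \<open>j\<close> and
  \<open>l\<close>; by \<open>pos_laplacian\<close> it lives at the two ends only, where it cancels
  the dependence on \<open>k\<close> of the terms from the new edge. This fixes the denominator:
  \<open>c\<close> is 1 plus the tree distance \<open>c - 1\<close> of the ends.\<close>

lemma res_laplacian:
  assumes j: "j \<in> V" and k: "k \<in> V"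
  shows "(\<Sum>l\<in>{l\<in>V. G j l}. res j k - res l k) =
    (2 - real (deg V E j) - (\<Sum>l\<in>nbrs j. (real (pos j))\<^sup>2 - (real (pos l))\<^sup>2) / real c
      + (ind (last vs) j - ind (hd vs) j) * (real c - 1) / real c)
     - (if j = k then 2 else 0)"
proof -
  let ?p = "\<lambda>x. real (pos x)" and ?u = "ind (last vs) j - ind (hd vs) j"
  have c0: "real c > 0" using vs_nonempty by simp
  have "(\<Sum>l\<in>nbrs j. res j k - res l k) =
    (\<Sum>l\<in>nbrs j. (real (tdist j k) - real (tdist l k)) - ((?p j)\<^sup>2 - (?p l)\<^sup>2) / real c
       + 2 * ?p k / real c * (?p j - ?p l))"
    using c0 by (intro sum.cong refl) (simp add: res_def field_simps power2_eq_square)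
  also have "\<dots> = (2 - real (deg V E j) - (if j = k then 2 else 0))
      - (\<Sum>l\<in>nbrs j. (?p j)\<^sup>2 - (?p l)\<^sup>2) / real c + 2 * ?p k / real c * ?u"
    by (simp only: sum.distrib sum_subtractf[of "\<lambda>l. real (tdist j k) - real (tdist l k)"] tdist_laplacian[OF j k]
        sum_divide_distrib[symmetric] sum_distrib_left[symmetric] pos_laplacian[OF j])
  finally have T: "(\<Sum>l\<in>nbrs j. res j k - res l k) = \<dots>" .
  have cr: "real (c - 1) = real c - 1" using len by (simp add: of_nat_diff)
  have hl: "res (last vs) k - res (hd vs) k = (real c - 1 - 2 * ?p k) - ((real c - 1 - ?p k)\<^sup>2 - (?p k)\<^sup>2) / real c"
    using tdist_hd[OF k] tdist_last[OF k] k ends cr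
    by (simp add: res_def tdist_commute[of _ k] diff_divide_distrib power2_commute)
  have "ind (hd vs) j * (res j k - res (last vs) k) + ind (last vs) j * (res j k - res (hd vs) k)
      = ?u * (res (last vs) k - res (hd vs) k)"
    using ends(3) by (auto simp: ind_def)
  also have "\<dots> = ?u * (real c - 1) / real c - 2 * ?p k / real c * ?u"
    unfolding hl using c0 by (simp add: field_simps power2_eq_square)
  finally show ?thesis unfolding sum_nbrs_G T by linarith
qed

lemma kemeny_G:
  "kemeny V G = (\<Sum>x\<in>V. \<Sum>y\<in>V. real (deg V G x) * real (deg V G y) * res x y) / (4 * real n)"
proof -
  have "card V \<ge> 2" using c_le_n len by simp
  from kemeny_resistance[OF sg_G con_G this _ _ res_laplacian]
  show ?thesis by (simp add: sum_deg_G_1 res_def tdist_commute power2_commute)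
qed

end

section \<open>Extremal sums\<close>

lemma sum_abs_diff:
  assumes "p < c"
  shows "(\<Sum>s<c. \<bar>real p - real s\<bar>) = (real p * (real p + 1) + (real c - 1 - real p) * (real c - real p)) / 2"
  using assms
proof (induction c)
  case (Suc c)
  show ?case
  proof (cases "p = c")
    case True
    have "(\<Sum>s<k. real p - real s) = real k * real p - real k * (real k - 1) / 2" for k
      by (induction k) (auto simp: field_simps)
    from this[of c] have "(\<Sum>s<c. \<bar>real p - real s\<bar>) = real p * (real p + 1) / 2"
      unfolding True by (simp add: field_simps)
    then show ?thesis using True by simp
  next
    case False
    then show ?thesis using Suc by (simp add: field_simps)
  qed
qed simp

lemma sum_square_diff:
  "(\<Sum>s<c. (p - real s)\<^sup>2) = real c * p\<^sup>2 - p * real c * (real c - 1) + real c * (real c - 1) * (2 * real c - 1) / 6"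
  by (induction c) (simp_all add: field_simps power2_eq_square)

lemma sum_sum_abs_diff: "(\<Sum>t<c. \<Sum>s<c. \<bar>real t - real s\<bar>) = real c * ((real c)\<^sup>2 - 1) / 3"
proof -
  \<comment> \<open>The parameter inside the summand is decoupled from the number of summands, so
    that the induction changes only the latter.\<close>
  have "(\<Sum>t<k. (real t * (real t + 1) + (C - 1 - real t) * (C - real t)) / 2)
     = (real k * (C\<^sup>2 - C) - (C - 1) * real k * (real k - 1) + (real k - 1) * real k * (2 * real k - 1) / 3) / 2" for k C
    by (induction k) (simp_all add: field_simps power2_eq_square)
  from this[of "real c" c] show ?thesis
    by (simp add: sum_abs_diff field_simps power2_eq_square)
qed

lemma sum_sum_square_diff: "(\<Sum>t<c. \<Sum>s<c. (real t - real s)\<^sup>2) = (real c)\<^sup>2 * ((real c)\<^sup>2 - 1) / 6"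
proof -
  have "(\<Sum>t<k. C * (real t)\<^sup>2 - real t * C * (C - 1) + C * (C - 1) * (2 * C - 1) / 6)
     = C * (real k - 1) * real k * (2 * real k - 1) / 6 - C * (C - 1) * real k * (real k - 1) / 2
       + real k * C * (C - 1) * (2 * C - 1) / 6" for k and C :: real
    by (induction k) (simp_all add: field_simps power2_eq_square)
  from this[of "real c" c] show ?thesis
    unfolding sum_square_diff by (simp add: field_simps power2_eq_square)
qed

text \<open>With \<open>j = m - k\<close> and \<open>q = m div 2\<close>, the deficit is
  \<open>(k - j)\<^sup>2 / 4\<close> for even \<open>m\<close>. For odd \<open>m\<close> it is
  \<open>(k - q) * (k - q - 1)\<close>, a product of consecutive integers, hence non-negative and
  zero only at \<open>k = q\<close> and \<open>k = q + 1\<close>.\<close>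

lemma balanced_product:
  fixes k m :: nat
  assumes "k \<le> m"
  shows "k * (m - k) \<le> (m div 2) * (m - m div 2)"
    and "k * (m - k) = (m div 2) * (m - m div 2) \<longleftrightarrow> k = m div 2 \<or> k = m - m div 2"
proof -
  define q where "q = m div 2"
  obtain j where m: "m = k + j" using assms le_Suc_ex by blast
  define a b where "a = int k" and "b = int j"
  have "m = 2 * q \<or> m = 2 * q + 1" unfolding q_def by presburger
  then have "k * j \<le> q * (m - q) \<and> (k * j = q * (m - q) \<longleftrightarrow> k = q \<or> k = m - q)"
  proof
    assume "m = 2 * q"
    then have q: "2 * int q = int k + int j" "m - q = q" using m by auto
    have e: "4 * (int q * int q - int k * int j) = (int k - int j)\<^sup>2"
    proof -
      have j: "int j = 2 * int q - int k" using q(1) by simp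
      show ?thesis unfolding j by (simp add: power2_eq_square algebra_simps)
    qed
    have "int k * int j = int q * int q \<longleftrightarrow> (int k - int j)\<^sup>2 = 0"
      unfolding e[symmetric] by auto
    then have "int k * int j = int q * int q \<longleftrightarrow> k = j" by simp
    moreover have "4 * (int q * int q - int k * int j) \<ge> 0" unfolding e by simp
    then have "int k * int j \<le> int q * int q" by simp
    moreover have "k = j \<longleftrightarrow> k = q" using q by linarith
    ultimately show ?thesis unfolding q(2) by (metis of_nat_le_iff of_nat_mult of_nat_eq_iff)
  next
    assume "m = 2 * q + 1"
    then have q: "int j = 2 * int q + 1 - int k" "m - q = q + 1" using m by auto
    have e: "int q * (int q + 1) - int k * int j = (int k - int q) * (int k - int q - 1)"
      unfolding q(1) by (simp add: algebra_simps)
    have "(int k - int q) * (int k - int q - 1) \<ge> 0"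
      by (cases "int k \<le> int q") (auto intro: mult_nonneg_nonneg mult_nonpos_nonpos)
    then have "int q * (int q + 1) - int k * int j \<ge> 0" unfolding e .
    then have "int (k * j) \<le> int (q * (q + 1))" by (simp add: algebra_simps)
    then have le: "k * j \<le> q * (q + 1)" by (simp only: of_nat_le_iff)
    have "int (k * j) = int (q * (q + 1)) \<longleftrightarrow> int q * (int q + 1) - int k * int j = 0" by (auto simp: algebra_simps)
    also have "\<dots> \<longleftrightarrow> k = q \<or> k = q + 1" unfolding e by auto
    finally show ?thesis unfolding q(2) using le by (simp only: of_nat_eq_iff)
  qed
  then show "k * (m - k) \<le> (m div 2) * (m - m div 2)"
    and "k * (m - k) = (m div 2) * (m - m div 2) \<longleftrightarrow> k = m div 2 \<or> k = m - m div 2"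
    unfolding q_def m by simp_all
qed

lemma sum_cut:
  assumes "finite X"
  shows "(\<Sum>x\<in>X. \<Sum>y\<in>X. (of_bool (P x) - of_bool (P y))\<^sup>2 :: real)
    = 2 * real (card {x\<in>X. P x} * (card X - card {x\<in>X. P x}))"
proof -
  let ?k = "card {x\<in>X. P x}" and ?\<chi> = "\<lambda>x. of_bool (P x) :: real"
  have k: "?k \<le> card X" using assms by (intro card_mono) auto
  have s: "(\<Sum>x\<in>X. ?\<chi> x) = real ?k" using assms by (simp add: of_bool_def sum.inter_filter[symmetric])
  have "(\<Sum>x\<in>X. \<Sum>y\<in>X. (?\<chi> x - ?\<chi> y)\<^sup>2) = (\<Sum>x\<in>X. \<Sum>y\<in>X. ?\<chi> x + ?\<chi> y - 2 * (?\<chi> x * ?\<chi> y))"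
    by (intro sum.cong refl) (simp add: of_bool_def)
  also have "\<dots> = 2 * (real (card X) * real ?k) - 2 * (real ?k * real ?k)"
    by (simp only: sum.distrib sum_subtractf sum_distrib_left[symmetric] sum_distrib_right[symmetric] s sum_constant)
  finally show ?thesis using k by (simp add: of_nat_diff algebra_simps)
qed

text \<open>\<open>\<bar>f x - f y\<bar>\<close> counts the cuts \<open>{..s}\<close> separating \<open>f x\<close> from \<open>f y\<close>.\<close>

lemma sum_abs_diff_le:
  fixes f :: "'a \<Rightarrow> nat"
  assumes X: "finite X" and f: "\<And>x. x \<in> X \<Longrightarrow> f x \<le> d"
  shows "(\<Sum>x\<in>X. \<Sum>y\<in>X. \<bar>real (f x) - real (f y)\<bar>)
     \<le> 2 * real d * real ((card X div 2) * (card X - card X div 2))"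
proof -
  have cut: "\<bar>real i - real j\<bar> = (\<Sum>s<d. (of_bool (i \<le> s) - of_bool (j \<le> s))\<^sup>2)" if "i \<le> d" "j \<le> d" for i j d :: nat
    using that
  proof (induction d)
    case (Suc d)
    show ?case
    proof (cases "i \<le> d \<and> j \<le> d")
      case True then show ?thesis using Suc by simp
    next
      case False
      \<comment> \<open>The first indicator vanishes for every \<open>s < k\<close>, so the sum
        counts the \<open>s\<close> with \<open>i \<le> s < k\<close>; truncated subtraction covers
        \<open>i \<ge> k\<close>.\<close>
      have e: "(\<Sum>s<k. (of_bool (Suc d \<le> s) - of_bool (i \<le> s))\<^sup>2 :: real) = real (k - i)" if "k \<le> Suc d" for k i
        using that by (induction k) (auto simp: of_bool_def Suc_diff_le)
      have e': "(\<Sum>s<k. (of_bool (i \<le> s) - of_bool (Suc d \<le> s))\<^sup>2 :: real) = real (k - i)" if "k \<le> Suc d" for k i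
        using e[OF that] by (simp add: power2_commute)
      from False Suc.prems have "i = Suc d \<or> j = Suc d" by auto
      then show ?thesis
        using e[of "Suc d" j] e'[of "Suc d" i] Suc.prems by (elim disjE) (simp_all add: of_nat_diff)
    qed
  qed simp
  have "(\<Sum>x\<in>X. \<Sum>y\<in>X. \<bar>real (f x) - real (f y)\<bar>) =
      (\<Sum>x\<in>X. \<Sum>y\<in>X. \<Sum>s<d. (of_bool (f x \<le> s) - of_bool (f y \<le> s))\<^sup>2)"
    by (intro sum.cong refl cut f)
  also have "\<dots> = (\<Sum>s<d. \<Sum>x\<in>X. \<Sum>y\<in>X. (of_bool (f x \<le> s) - of_bool (f y \<le> s))\<^sup>2)"
    by (subst (2) sum.swap, subst sum.swap) simp
  also have "\<dots> \<le> (\<Sum>s<d. 2 * real ((card X div 2) * (card X - card X div 2)))"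
  proof (intro sum_mono)
    fix s
    have "card {x\<in>X. f x \<le> s} \<le> card X" using X by (intro card_mono) auto
    from balanced_product(1)[OF this]
    show "(\<Sum>x\<in>X. \<Sum>y\<in>X. (of_bool (f x \<le> s) - of_bool (f y \<le> s))\<^sup>2)
        \<le> 2 * real ((card X div 2) * (card X - card X div 2))"
      unfolding sum_cut[OF X] by (simp only: of_nat_le_iff mult_le_cancel_left_pos zero_less_numeral)
  qed
  finally show ?thesis by simp
qed

section \<open>The difference of the two constants in terms of positions\<close>

context tree_with_path
begin

abbreviation X :: "'a set" where "X \<equiv> V - set vs"
abbreviation P :: "'a \<Rightarrow> real" where "P x \<equiv> real (pos x)"

lemma card_X: "card X = n - c"
  using card_Diff_subset[OF _ set_vs] distinct_card[OF distinct_vs] by simp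

lemma sum_V: "(\<Sum>x\<in>V. g x) = (\<Sum>x\<in>X. g x) + (\<Sum>s<c. g (vs ! s))"
proof -
  have "(\<Sum>x\<in>set vs. g x) = (\<Sum>s<c. g (vs ! s))"
    using distinct_vs by (metis bij_betw_nth lessThan_atLeast0 sum.reindex_bij_betw)
  then show ?thesis using sum.subset_diff[OF set_vs fin, of g] by simp
qed

lemma nxt_on_path:
  assumes "Suc s < c"
  shows "nxt (hd vs) (vs ! Suc s) = vs ! s"
proof -
  note v = vs_in_V[OF assms] vs_in_V[of s]
  have "E (vs ! Suc s) (vs ! s)" using path assms symE by (auto simp: is_path_def)
  moreover have "real (tdist (vs ! s) (hd vs)) < real (tdist (vs ! Suc s) (hd vs))"
    using assms v by (simp add: tdist_hd ht_vs pos_vs)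
  ultimately show ?thesis using nxt_unique[OF v(1) ends(1)] by fastforce
qed

text \<open>Orient the tree edges towards \<open>hd vs\<close>. The edge owned by an off-path vertex
  has both ends at one position, and the path edges together with the new edge form a cycle that
  meets each position twice. For functions of the position the degrees in \<open>G\<close> therefore
  act as the constant weight 2.\<close>

lemma sum_deg_G_pos:
  fixes f :: "nat \<Rightarrow> real"
  shows "(\<Sum>x\<in>V. real (deg V G x) * f (pos x)) = 2 * (\<Sum>x\<in>V. f (pos x))"
proof -
  obtain m where c: "c = Suc m" using vs_nonempty by (cases vs) auto
  let ?g = "\<lambda>x. f (pos x) + f (pos (nxt (hd vs) x))"
  have X: "(\<Sum>x\<in>X. ?g x) = 2 * (\<Sum>x\<in>X. f (pos x))"
    unfolding sum_distrib_left using nxt_off_path(2)[where s = 0] vs_nonempty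
    by (intro sum.cong refl) (simp add: hd_vs)
  have path_sum: "(\<Sum>s<m. ?g (vs ! Suc s)) = (\<Sum>s<m. f (Suc s)) + (\<Sum>s<m. f s)"
    unfolding sum.distrib[symmetric]
    using c nxt_on_path pos_vs by (intro sum.cong refl) simp
  \<comment> \<open>The value \<open>nxt (hd vs) (hd vs)\<close> is unspecified;
    \<open>?g (hd vs)\<close> is added only to sum over all of \<open>V\<close> and is cancelled
    afterwards.\<close>
  have "(\<Sum>x\<in>V - {hd vs}. ?g x) + ?g (hd vs) = (\<Sum>x\<in>V. ?g x)"
    using ends(1) fin by (simp add: sum.remove[of V "hd vs"])
  also have "\<dots> = (\<Sum>x\<in>X. ?g x) + (?g (hd vs) + (\<Sum>s<m. ?g (vs ! Suc s)))"
  proof -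
    have "(\<Sum>s<c. ?g (vs ! s)) = ?g (hd vs) + (\<Sum>s<m. ?g (vs ! Suc s))"
      unfolding c sum.lessThan_Suc_shift hd_vs ..
    then show ?thesis using sum_V[of ?g] by linarith
  qed
  finally have "(\<Sum>x\<in>V - {hd vs}. ?g x) = (\<Sum>x\<in>X. ?g x) + (\<Sum>s<m. ?g (vs ! Suc s))" by simp
  then have 1: "(\<Sum>x\<in>V. real (deg V G x) * f (pos x)) =
      2 * (\<Sum>x\<in>X. f (pos x)) + (\<Sum>s<m. f (Suc s)) + (\<Sum>s<m. f s) + f 0 + f m"
    using ends c by (simp add: sum_deg_G sum_deg[OF ends(1)] X path_sum)
  have "(\<Sum>s<c. f (pos (vs ! s))) = (\<Sum>s<c. f s)" by (intro sum.cong) (simp_all add: pos_vs)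
  moreover have "(\<Sum>s<c. f s) = f 0 + (\<Sum>s<m. f (Suc s))" unfolding c by (rule sum.lessThan_Suc_shift)
  moreover have "(\<Sum>s<c. f s) = (\<Sum>s<m. f s) + f m" unfolding c by simp
  ultimately have "2 * (\<Sum>s<c. f (pos (vs ! s))) = (f 0 + (\<Sum>s<m. f (Suc s))) + ((\<Sum>s<m. f s) + f m)"
    by (metis mult_2)
  then show ?thesis unfolding 1 sum_V[of "\<lambda>x. f (pos x)"] distrib_left by simp
qed

text \<open>On the diagonal the estimate \<open>tdist_le\<close> always loses
  \<open>2 * ht x\<close>. Putting 0 there moves this loss into the factor \<open>n - 1\<close> of
  \<open>sum_tdist\<close>, so that \<open>excess\<close> can vanish everywhere.\<close>

definition excess :: "'a \<Rightarrow> 'a \<Rightarrow> real" where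
  "excess x y = (if x = y then 0 else real (ht x) + real (ht y) + \<bar>P x - P y\<bar> - real (tdist x y))"

lemma excess_nonneg: "x \<in> V \<Longrightarrow> y \<in> V \<Longrightarrow> excess x y \<ge> 0"
  using tdist_le by (simp add: excess_def)

lemma sum_tdist:
  "(\<Sum>x\<in>V. \<Sum>y\<in>V. real (tdist x y)) =
    2 * (real n - 1) * (\<Sum>x\<in>V. real (ht x)) + (\<Sum>x\<in>V. \<Sum>y\<in>V. \<bar>P x - P y\<bar>) - (\<Sum>x\<in>V. \<Sum>y\<in>V. excess x y)"
proof -
  have "(\<Sum>x\<in>V. \<Sum>y\<in>V. real (tdist x y)) =
    (\<Sum>x\<in>V. \<Sum>y\<in>V. real (ht x) + real (ht y) + \<bar>P x - P y\<bar> - excess x y - (if x = y then 2 * real (ht x) else 0))"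
    by (intro sum.cong refl) (simp add: excess_def)
  also have "\<dots> = 2 * (real n - 1) * (\<Sum>x\<in>V. real (ht x)) + (\<Sum>x\<in>V. \<Sum>y\<in>V. \<bar>P x - P y\<bar>)
      - (\<Sum>x\<in>V. \<Sum>y\<in>V. excess x y)"
    using fin by (simp add: sum.distrib sum_subtractf sum_distrib_left[symmetric] algebra_simps)
  finally show ?thesis .
qed

text \<open>In the distance part, the extra unit of degree at each end brings in the distances to
  both ends, whose sum \<open>2 * ht y + c - 1\<close> is free of positions. In the quadratic part,
  \<open>sum_deg_G_pos\<close> used in each variable yields the factor 4.\<close>

lemma sum_deg_G_deg_G_res:
  "(\<Sum>x\<in>V. \<Sum>y\<in>V. real (deg V G x) * real (deg V G y) * res x y) =
    (\<Sum>x\<in>V. \<Sum>y\<in>V. real (deg V E x) * real (deg V E y) * real (tdist x y))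
    + 8 * (\<Sum>x\<in>V. real (ht x)) + 4 * real n * (real c - 1) - 4 * (real n - 1) + 2 * (real c - 1)
    - 4 * (\<Sum>x\<in>V. \<Sum>y\<in>V. (P x - P y)\<^sup>2) / real c"
proof -
  let ?d = "\<lambda>x. real (deg V E x)" and ?D = "\<lambda>x. real (deg V G x)" and ?a = "hd vs" and ?b = "last vs"
  let ?t = "\<lambda>x y. real (tdist x y)"
  have 1: "(\<Sum>x\<in>V. \<Sum>y\<in>V. ?D x * ?D y * res x y) =
     (\<Sum>x\<in>V. ?D x * (\<Sum>y\<in>V. ?D y * ?t x y)) - (\<Sum>x\<in>V. ?D x * (\<Sum>y\<in>V. ?D y * (P x - P y)\<^sup>2)) / real c"
    by (simp add: res_def right_diff_distrib sum_subtractf sum_distrib_left sum_divide_distrib mult.assoc)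
  have 2: "(\<Sum>x\<in>V. ?D x * (\<Sum>y\<in>V. ?D y * (P x - P y)\<^sup>2)) = 4 * (\<Sum>x\<in>V. \<Sum>y\<in>V. (P x - P y)\<^sup>2)"
    using sum_deg_G_pos[of "\<lambda>q. (r - real q)\<^sup>2" for r] sum_deg_G_pos[of "\<lambda>r. 2 * (\<Sum>y\<in>V. (real r - P y)\<^sup>2)"]
    by (simp add: sum_distrib_left[symmetric])
  have 3: "(\<Sum>x\<in>V. ?D x * (\<Sum>y\<in>V. ?D y * ?t x y)) =
     (\<Sum>x\<in>V. \<Sum>y\<in>V. ?d x * ?d y * ?t x y) + 2 * (\<Sum>y\<in>V. ?d y * (?t y ?a + ?t y ?b)) + 2 * (real c - 1)"
  proof -
    have "(\<Sum>x\<in>V. ?D x * (\<Sum>y\<in>V. ?D y * ?t x y)) =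
       (\<Sum>x\<in>V. ?d x * (\<Sum>y\<in>V. ?d y * ?t x y)) + (\<Sum>x\<in>V. ?d x * ?t x ?a) + (\<Sum>x\<in>V. ?d x * ?t x ?b)
       + (\<Sum>y\<in>V. ?d y * ?t ?a y) + (\<Sum>y\<in>V. ?d y * ?t ?b y) + ?t ?a ?b + ?t ?b ?a"
      by (simp add: sum_deg_G distrib_left sum.distrib)
    moreover have "(\<Sum>y\<in>V. ?d y * ?t u y) = (\<Sum>y\<in>V. ?d y * ?t y u)" if "u \<in> V" for u
      using tdist_commute[OF that] by (intro sum.cong) simp_all
    moreover have "?t ?a ?b = real c - 1" "?t ?b ?a = real c - 1"
      using tdist_last[OF ends(1)] tdist_hd[OF ends(2)] vs_nonempty
      by (simp_all add: ends(5-8) of_nat_diff Suc_le_eq)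
    moreover have "(\<Sum>y\<in>V. ?d y * (?t y ?a + ?t y ?b)) = (\<Sum>y\<in>V. ?d y * ?t y ?a) + (\<Sum>y\<in>V. ?d y * ?t y ?b)"
      by (simp add: distrib_left sum.distrib)
    moreover have "(\<Sum>x\<in>V. ?d x * (\<Sum>y\<in>V. ?d y * ?t x y)) = (\<Sum>x\<in>V. \<Sum>y\<in>V. ?d x * ?d y * ?t x y)"
      by (simp add: sum_distrib_left mult.assoc)
    ultimately show ?thesis using ends(1,2) by simp
  qed
  have 4: "(\<Sum>y\<in>V. ?d y * (?t y ?a + ?t y ?b)) = 4 * (\<Sum>x\<in>V. real (ht x)) + 2 * real n * (real c - 1) - 2 * (real n - 1)"
  proof -
    have "(\<Sum>y\<in>V. ?t y ?a) + (\<Sum>y\<in>V. ?t y ?b) = (\<Sum>y\<in>V. 2 * real (ht y) + (real c - 1))"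
      unfolding sum.distrib[symmetric] by (intro sum.cong refl) (simp add: tdist_hd tdist_last)
    also have "\<dots> = 2 * (\<Sum>x\<in>V. real (ht x)) + real n * (real c - 1)"
      by (simp add: sum.distrib sum_distrib_left)
    finally show ?thesis using sum_deg_tdist[OF ends(1)] sum_deg_tdist[OF ends(2)]
      by (simp add: distrib_left sum.distrib)
  qed
  show ?thesis unfolding 1 2 3 4 by simp
qed

text \<open>The relative weight of the two terms is the one with which they enter
  \<open>4 n (n - 1) (K(G) - K(T))\<close>.\<close>

definition spread :: "'a set \<Rightarrow> real" where
  "spread S = (\<Sum>x\<in>S. \<Sum>y\<in>S. \<bar>P x - P y\<bar> + (real n - 1) / real c * (P x - P y)\<^sup>2)"

text \<open>The combination is \<open>(n - 1) * (S + 8 * H + ...) - n * S\<close>. The heights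
  inside \<open>-S\<close> amount to \<open>-8 * (n - 1) * H\<close> and cancel, while
  \<open>excess\<close> appears with a positive sign.\<close>

lemma kemeny_diff:
  "4 * real n * (real n - 1) * (kemeny V G - kemeny V E) =
     4 * (\<Sum>x\<in>V. \<Sum>y\<in>V. excess x y) - 4 * spread V
     + 4 * real n * (real n - 1) * (real c - 1) + 2 * (real n - 1) * real c"
proof -
  have n2: "n \<ge> 2" using c_le_n len by simp
  then have n: "real n > 1" by simp
  have c0: "real c > 0" using vs_nonempty by simp
  define S where "S = (\<Sum>x\<in>V. \<Sum>y\<in>V. real (deg V E x) * real (deg V E y) * real (tdist x y))"
  define Z where "Z = (\<Sum>x\<in>V. \<Sum>y\<in>V. (P x - P y)\<^sup>2)"
  define Y where "Y = (\<Sum>x\<in>V. \<Sum>y\<in>V. \<bar>P x - P y\<bar>)"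
  define H where "H = (\<Sum>x\<in>V. real (ht x))"
  have sp: "spread V = Y + (real n - 1) / real c * Z"
    by (simp add: spread_def Y_def Z_def sum.distrib sum_distrib_left)
  have S: "S = 4 * (2 * (real n - 1) * H + Y - (\<Sum>x\<in>V. \<Sum>y\<in>V. excess x y)) - 2 * (real n - 1) * (2 * real n - 1)"
    unfolding S_def sum_deg_deg_tdist sum_tdist H_def Y_def ..
  have "kemeny V E = S / (4 * (real n - 1))" unfolding kemeny_tree[OF n2] S_def sum_deg_deg_tdist ..
  then have kT: "4 * (real n - 1) * kemeny V E = S" using n by (simp add: field_simps)
  have "kemeny V G = (S + 8 * H + 4 * real n * (real c - 1) - 4 * (real n - 1) + 2 * (real c - 1) - 4 * Z / real c) / (4 * real n)"
    unfolding kemeny_G sum_deg_G_deg_G_res S_def Z_def H_def ..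
  then have kG: "4 * real n * kemeny V G = S + 8 * H + 4 * real n * (real c - 1) - 4 * (real n - 1) + 2 * (real c - 1) - 4 * (Z / real c)"
    using n by (simp add: field_simps)
  have "4 * real n * (real n - 1) * (kemeny V G - kemeny V E) =
     (real n - 1) * (4 * real n * kemeny V G) - real n * (4 * (real n - 1) * kemeny V E)"
    by (simp add: algebra_simps)
  then show ?thesis unfolding kG kT sp using S by (simp add: algebra_simps)
qed

text \<open>Split \<open>V\<close> into \<open>X\<close> and the path. Against the whole path, a
  vertex at position \<open>p\<close> loses \<open>p * (c - 1 - p)\<close> from the absolute values
  and \<open>n - 1\<close> times as much from the squares, hence \<open>n\<close> in total; the loss
  vanishes exactly at the ends.\<close>

lemma spread_V:
  "spread V = real c * ((real c)\<^sup>2 - 1) * (real n + 1) / 6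
     + (real n - real c) * (real c * (real c - 1) + (real n - 1) * (real c - 1) * (2 * real c - 1) / 3)
     - 2 * real n * (\<Sum>x\<in>X. P x * (real c - 1 - P x)) + spread X"
proof -
  let ?\<phi> = "\<lambda>s t. \<bar>s - t\<bar> + (real n - 1) / real c * (s - t)\<^sup>2"
  have c0: "real c > 0" using vs_nonempty by simp
  have \<phi>sym: "?\<phi> s t = ?\<phi> t s" for s t :: real by (simp add: abs_minus_commute power2_commute)
  have mixed: "(\<Sum>s<c. ?\<phi> (P x) (real s)) =
     (real c * (real c - 1) + (real n - 1) * (real c - 1) * (2 * real c - 1) / 3) / 2 - real n * (P x * (real c - 1 - P x))"
    if "x \<in> X" for x
  proof -
    have 1: "(\<Sum>s<c. ?\<phi> (P x) (real s)) = (\<Sum>s<c. \<bar>P x - real s\<bar>) + (real n - 1) / real c * (\<Sum>s<c. (P x - real s)\<^sup>2)"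
      by (simp add: sum.distrib sum_distrib_left)
    have "pos x < c" using pos_less[of x] that by simp
    then show ?thesis unfolding 1 sum_abs_diff[OF \<open>pos x < c\<close>] sum_square_diff
      using c0 by (simp add: field_simps power2_eq_square)
  qed
  have pp: "(\<Sum>t<c. \<Sum>s<c. ?\<phi> (real t) (real s)) = real c * ((real c)\<^sup>2 - 1) * (real n + 1) / 6"
  proof -
    have 1: "(\<Sum>t<c. \<Sum>s<c. ?\<phi> (real t) (real s)) =
      (\<Sum>t<c. \<Sum>s<c. \<bar>real t - real s\<bar>) + (real n - 1) / real c * (\<Sum>t<c. \<Sum>s<c. (real t - real s)\<^sup>2)"
      by (simp add: sum.distrib sum_distrib_left)
    show ?thesis unfolding 1 sum_sum_abs_diff sum_sum_square_diff
      using c0 by (simp add: field_simps power2_eq_square)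
  qed
  have "spread V = (\<Sum>x\<in>X. (\<Sum>y\<in>X. ?\<phi> (P x) (P y)) + (\<Sum>s<c. ?\<phi> (P x) (real s)))
      + (\<Sum>t<c. (\<Sum>y\<in>X. ?\<phi> (real t) (P y)) + (\<Sum>s<c. ?\<phi> (real t) (real s)))"
    unfolding spread_def sum_V by (simp add: pos_vs cong: sum.cong_simp)
  also have "\<dots> = spread X + 2 * (\<Sum>x\<in>X. \<Sum>s<c. ?\<phi> (P x) (real s)) + (\<Sum>t<c. \<Sum>s<c. ?\<phi> (real t) (real s))"
  proof -
    have "(\<Sum>t<c. \<Sum>y\<in>X. ?\<phi> (real t) (P y)) = (\<Sum>x\<in>X. \<Sum>s<c. ?\<phi> (P x) (real s))"
      by (subst sum.swap) (intro sum.cong refl \<phi>sym)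
    then show ?thesis unfolding spread_def sum.distrib[of "\<lambda>x. (\<Sum>y\<in>X. ?\<phi> (P x) (P y))"]
        sum.distrib[of "\<lambda>t. (\<Sum>y\<in>X. ?\<phi> (real t) (P y))"] by simp
  qed
  also have "(\<Sum>x\<in>X. \<Sum>s<c. ?\<phi> (P x) (real s)) = (\<Sum>x\<in>X.
      (real c * (real c - 1) + (real n - 1) * (real c - 1) * (2 * real c - 1) / 3) / 2 - real n * (P x * (real c - 1 - P x)))"
    by (rule sum.cong[OF refl mixed])
  also have "\<dots> = (real n - real c) * ((real c * (real c - 1) + (real n - 1) * (real c - 1) * (2 * real c - 1) / 3) / 2)
      - real n * (\<Sum>x\<in>X. P x * (real c - 1 - P x))"
    using c_le_n by (simp only: sum_subtractf sum_distrib_left sum_constant card_X of_nat_diff)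
  finally have e: "spread V = spread X + 2 * \<dots> + (\<Sum>t<c. \<Sum>s<c. ?\<phi> (real t) (real s))" .
  have "s + 2 * (a * (m / 2) - b * u) + t = t + a * m - 2 * b * u + s" for s a m b u t :: real
    by (simp add: algebra_simps)
  then show ?thesis unfolding e pp .
qed

text \<open>The value for an even division between the ends: each ordered pair with vertices at
  opposite ends contributes \<open>(c - 1) * (1 + (n - 1) * (c - 1) / c)\<close>. Times
  \<open>4 * c\<close>, this is the floor and ceiling term of the bound.\<close>

definition max_spread :: real where
  "max_spread = 2 * (real c - 1) * (1 + (real n - 1) * (real c - 1) / real c)
     * real ((n - c) div 2 * (n - c - (n - c) div 2))"

text \<open>Positions differ by at most \<open>c - 1\<close>, so a squared difference is at most
  \<open>c - 1\<close> times the absolute one, with equality for differences 0 and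
  \<open>c - 1\<close>. The linear sum that remains is bounded by cuts.\<close>

lemma spread_X_le: "spread X \<le> max_spread"
proof -
  have c1: "real c \<ge> 1" using vs_nonempty by (simp add: Suc_le_eq)
  have n1: "real n \<ge> 1" using c_le_n vs_nonempty by (cases vs) auto
  let ?K = "1 + (real n - 1) * (real c - 1) / real c"
  have K: "?K \<ge> 0" using n1 c1 by simp
  have "spread X \<le> (\<Sum>x\<in>X. \<Sum>y\<in>X. ?K * \<bar>P x - P y\<bar>)"
    unfolding spread_def
  proof (intro sum_mono)
    fix x y assume xy: "x \<in> X" "y \<in> X"
    then have "pos x < c" "pos y < c" using pos_less by auto
    then have "\<bar>P x - P y\<bar> \<le> real c - 1" by linarith
    then have "(P x - P y)\<^sup>2 \<le> (real c - 1) * \<bar>P x - P y\<bar>"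
      by (metis abs_ge_zero mult_right_mono power2_abs power2_eq_square)
    then have "(real n - 1) / real c * (P x - P y)\<^sup>2 \<le> (real n - 1) / real c * ((real c - 1) * \<bar>P x - P y\<bar>)"
      using n1 c1 by (intro mult_left_mono) auto
    moreover have "?K * \<bar>P x - P y\<bar> = \<bar>P x - P y\<bar> + (real n - 1) / real c * ((real c - 1) * \<bar>P x - P y\<bar>)"
      using c1 by (simp add: field_simps)
    ultimately show "\<bar>P x - P y\<bar> + (real n - 1) / real c * (P x - P y)\<^sup>2 \<le> ?K * \<bar>P x - P y\<bar>"
      by linarith
  qed
  also have "\<dots> = ?K * (\<Sum>x\<in>X. \<Sum>y\<in>X. \<bar>P x - P y\<bar>)" by (simp add: sum_distrib_left)
  also have "\<dots> \<le> ?K * (2 * real (c - 1) * real (card X div 2 * (card X - card X div 2)))"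
  proof (intro mult_left_mono K sum_abs_diff_le)
    show "pos x \<le> c - 1" if "x \<in> X" for x using pos_less[of x] that by auto
  qed (use fin in simp)
  also have "\<dots> = max_spread" using c1 by (simp add: max_spread_def card_X of_nat_diff)
  finally show ?thesis .
qed

text \<open>With all positions at the ends a summand is 0 or the positive constant \<open>K\<close>,
  so the spread counts separated pairs and \<open>balanced_product\<close> settles equality.\<close>

lemma spread_X_ends:
  assumes "\<And>x. x \<in> X \<Longrightarrow> pos x = 0 \<or> pos x = c - 1"
  shows "spread X = max_spread \<longleftrightarrow>
    card {x\<in>X. pos x = 0} = (n - c) div 2 \<or> card {x\<in>X. pos x = 0} = n - c - (n - c) div 2"
proof -
  have c1: "real c > 1" using len by simp
  have n1: "real n \<ge> 1" using c_le_n vs_nonempty by (cases vs) auto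
  define K where "K = (real c - 1) * (1 + (real n - 1) * (real c - 1) / real c)"
  let ?k = "card {x\<in>X. pos x = 0}"
  have "(real n - 1) * (real c - 1) / real c \<ge> 0" using n1 c1 by simp
  then have K: "K > 0" unfolding K_def using c1 by (intro mult_pos_pos) linarith+
  have cr: "real (c - 1) = real c - 1" "c - 1 \<noteq> 0" using len by (simp_all add: of_nat_diff)
  have "spread X = (\<Sum>x\<in>X. \<Sum>y\<in>X. K * (of_bool (pos x = 0) - of_bool (pos y = 0))\<^sup>2)"
    unfolding spread_def
  proof (intro sum.cong refl)
    fix x y assume "x \<in> X" "y \<in> X"
    then have "pos x = 0 \<or> pos x = c - 1" "pos y = 0 \<or> pos y = c - 1" using assms by auto
    then show "\<bar>P x - P y\<bar> + (real n - 1) / real c * (P x - P y)\<^sup>2 =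
      K * (of_bool (pos x = 0) - of_bool (pos y = 0))\<^sup>2"
      using cr c1 by (elim disjE) (simp_all add: K_def field_simps power2_eq_square)
  qed
  also have "\<dots> = K * (2 * real (?k * (card X - ?k)))"
    using fin by (simp only: sum_distrib_left[symmetric] sum_cut finite_Diff)
  finally have "spread X = K * (2 * real (?k * (card X - ?k)))" .
  moreover have "max_spread = K * (2 * real ((n - c) div 2 * (n - c - (n - c) div 2)))"
    unfolding max_spread_def K_def by (simp only: mult_ac)
  ultimately have "spread X = max_spread \<longleftrightarrow> real (?k * (card X - ?k)) = real ((n - c) div 2 * (n - c - (n - c) div 2))"
    using K by simp
  also have "\<dots> \<longleftrightarrow> ?k * (n - c - ?k) = (n - c) div 2 * (n - c - (n - c) div 2)"
    unfolding of_nat_eq_iff card_X ..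
  finally have 1: "spread X = max_spread \<longleftrightarrow> ?k * (n - c - ?k) = (n - c) div 2 * (n - c - (n - c) div 2)" .
  have "?k \<le> n - c" unfolding card_X[symmetric] using fin by (intro card_mono) auto
  then show ?thesis unfolding 1 by (rule balanced_product(2))
qed

end

section \<open>The lower bound and its equality case\<close>

context tree_with_path
begin

text \<open>An identity rather than an estimate, so that the inequality and its equality case both
  reduce to the sign of one slack term.\<close>

lemma kemeny_diff_bound:
  "kemeny V G - kemeny V E =
    (1 / (4 * real c * real n * (real n - 1))) *
       (- (2/3) * (real n + 1) * (real c)^2 * ((real c)^2 - 1)
        - 8 * (real n - real c) * (- real n * (real c)^2
             + real c * (real c + 1) / 6 * ((2 * real n + 1) * real c + real n - 1))
        - 8 * real ((n - c) div 2) * real (n - c - (n - c) div 2)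
             * ((real n - 1) * (real c - 1)^2 + real c * (real c - 1))
        + 4 * real n * (real n - 1) * real c * (real c - 1)
        + 2 * (real n - 1) * (real c)^2)
    + ((\<Sum>x\<in>V. \<Sum>y\<in>V. excess x y) + 2 * real n * (\<Sum>x\<in>X. P x * (real c - 1 - P x))
        + (max_spread - spread X)) / (real n * (real n - 1))"
    (is "?K = 1 / ?N * ?B + ?S / ?M")
proof -
  have n: "real n > 1" using c_le_n len by simp
  have c0: "real c > 0" using vs_nonempty by simp
  have "4 * ?M * ?K = 4 * real n * (real n - 1) * ?K" by simp
  also have "\<dots> = ?B / real c + 4 * ?S"
  proof -
    \<comment> \<open>Pure algebra over reals: \<open>e\<close> stands for the total excess,
      \<open>u\<close> for the sum of \<open>p * (c - 1 - p)\<close>, \<open>s\<close> for the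
      spread of \<open>X\<close>, and \<open>f\<close>, \<open>g\<close> for the two halves of
      \<open>n - c\<close>.\<close>
    have id: "4 * e - 4 * (c * (c\<^sup>2 - 1) * (n + 1) / 6 + (n - c) * (c * (c - 1) + (n - 1) * (c - 1) * (2 * c - 1) / 3)
        - 2 * n * u + s) + 4 * n * (n - 1) * (c - 1) + 2 * (n - 1) * c =
      (- (2/3) * (n + 1) * c^2 * (c^2 - 1)
        - 8 * (n - c) * (- n * c^2 + c * (c + 1) / 6 * ((2 * n + 1) * c + n - 1))
        - 8 * f * g * ((n - 1) * (c - 1)^2 + c * (c - 1)) + 4 * n * (n - 1) * c * (c - 1) + 2 * (n - 1) * c^2) / c
      + 4 * (e + 2 * n * u + (2 * (c - 1) * (1 + (n - 1) * (c - 1) / c) * (f * g) - s))"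
      if "c > 0" for c n e u s f g :: real
      using that by (simp add: field_simps power2_eq_square)
    show ?thesis unfolding kemeny_diff spread_V max_spread_def of_nat_mult by (rule id[OF c0])
  qed
  finally have 1: "4 * ?M * ?K = ?B / real c + 4 * ?S" .
  have 2: "k = 1 / (4 * r * m) * b + s / m" if "4 * m * k = b / r + 4 * s" "r > 0" "m > 0" for k b r s m :: real
    using that by (simp add: field_simps)
  have M: "?M > 0" using n by simp
  have N: "?N = 4 * real c * ?M" by simp
  show ?thesis unfolding N by (rule 2[OF 1 c0 M])
qed

definition extremal :: bool where
  "extremal \<longleftrightarrow> (\<forall>x\<in>V. \<forall>y\<in>V. excess x y = 0) \<and> (\<forall>x\<in>X. pos x = 0 \<or> pos x = c - 1) \<and>
     (card {x\<in>X. pos x = 0} = (n - c) div 2 \<or> card {x\<in>X. pos x = 0} = n - c - (n - c) div 2)"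

text \<open>Each of the three terms is non-negative. When the middle one vanishes, all off-path
  vertices lie over the ends, which is what \<open>spread_X_ends\<close> needs to decide the
  third.\<close>

lemma slack:
  defines "S \<equiv> (\<Sum>x\<in>V. \<Sum>y\<in>V. excess x y) + 2 * real n * (\<Sum>x\<in>X. P x * (real c - 1 - P x))
        + (max_spread - spread X)"
  shows "S \<ge> 0" "S = 0 \<longleftrightarrow> extremal"
proof -
  have n: "real n > 0" using c_le_n vs_nonempty by (cases vs) auto
  have pn: "P x * (real c - 1 - P x) \<ge> 0" if "x \<in> X" for x
    using pos_less[of x] that by (intro mult_nonneg_nonneg) auto
  have e0: "(\<Sum>x\<in>V. \<Sum>y\<in>V. excess x y) \<ge> 0" by (intro sum_nonneg excess_nonneg)
  have p0: "(\<Sum>x\<in>X. P x * (real c - 1 - P x)) \<ge> 0" by (intro sum_nonneg pn)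
  have np0: "2 * real n * (\<Sum>x\<in>X. P x * (real c - 1 - P x)) \<ge> 0" using n p0 by simp
  show "S \<ge> 0" unfolding S_def using e0 np0 spread_X_le by linarith
  have "S = 0 \<longleftrightarrow> (\<Sum>x\<in>V. \<Sum>y\<in>V. excess x y) = 0 \<and> 2 * real n * (\<Sum>x\<in>X. P x * (real c - 1 - P x)) = 0
      \<and> spread X = max_spread"
    unfolding S_def using e0 np0 spread_X_le by linarith
  also have "2 * real n * (\<Sum>x\<in>X. P x * (real c - 1 - P x)) = 0 \<longleftrightarrow> (\<Sum>x\<in>X. P x * (real c - 1 - P x)) = 0"
    using n by simp
  also have "\<dots> \<longleftrightarrow> (\<forall>x\<in>X. P x * (real c - 1 - P x) = 0)"
    by (intro sum_nonneg_eq_0_iff pn finite_Diff fin)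
  also have "\<dots> \<longleftrightarrow> (\<forall>x\<in>X. pos x = 0 \<or> pos x = c - 1)"
  proof (intro ball_cong refl)
    fix x assume "x \<in> X"
    have *: "real c - 1 = real (c - 1)" using vs_nonempty by (simp add: of_nat_diff Suc_le_eq)
    show "(P x * (real c - 1 - P x) = 0) = (pos x = 0 \<or> pos x = c - 1)"
      unfolding * mult_eq_0_iff right_minus_eq of_nat_eq_iff of_nat_eq_0_iff by auto
  qed
  also have "(\<Sum>x\<in>V. \<Sum>y\<in>V. excess x y) = 0 \<longleftrightarrow> (\<forall>x\<in>V. (\<Sum>y\<in>V. excess x y) = 0)"
    by (intro sum_nonneg_eq_0_iff fin sum_nonneg excess_nonneg)
  also have "\<dots> \<longleftrightarrow> (\<forall>x\<in>V. \<forall>y\<in>V. excess x y = 0)"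
    by (intro ball_cong refl sum_nonneg_eq_0_iff fin excess_nonneg)
  finally show "S = 0 \<longleftrightarrow> extremal" using spread_X_ends unfolding extremal_def by blast
qed

section \<open>The shape of the extremal trees\<close>

definition brooms :: "'a set \<Rightarrow> 'a set \<Rightarrow> bool" where
  "brooms A B \<longleftrightarrow> (\<forall>x y. E x y \<longleftrightarrow>
     (\<exists>i. Suc i < c \<and> ((x = vs ! i \<and> y = vs ! Suc i) \<or> (y = vs ! i \<and> x = vs ! Suc i)))
     \<or> (x \<in> A \<and> y = hd vs) \<or> (y \<in> A \<and> x = hd vs)
     \<or> (x \<in> B \<and> y = last vs) \<or> (y \<in> B \<and> x = last vs))"

text \<open>Zero excess along an edge reads \<open>1 = ht x + ht y + \<bar>P x - P y\<bar>\<close>.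
  For an off-path vertex and its next vertex, which has the same position and height one less, this
  forces height 1; then every edge at \<open>x\<close> ends in the path vertex at the position of
  \<open>x\<close>.\<close>

lemma extremal_imp_brooms:
  assumes ex: "\<And>x y. x \<in> V \<Longrightarrow> y \<in> V \<Longrightarrow> excess x y = 0"
    and po: "\<And>x. x \<in> X \<Longrightarrow> pos x = 0 \<or> pos x = c - 1"
  shows "brooms {x\<in>X. pos x = 0} {x\<in>X. pos x = c - 1}"
proof -
  let ?A = "{x\<in>X. pos x = 0}" and ?B = "{x\<in>X. pos x = c - 1}"
  have d: "real (tdist x y) = real (ht x) + real (ht y) + \<bar>P x - P y\<bar>" if "x \<in> V" "y \<in> V" "x \<noteq> y" for x y
    using ex[OF that(1,2)] that(3) by (simp add: excess_def)
  have h_pos: "ht x \<ge> 1" if "x \<in> X" for x using ht_eq_0[of x] that by (cases "ht x") auto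
  have h1: "ht x = 1" if x: "x \<in> X" for x
  proof -
    have x': "x \<in> V" "x \<notin> set vs" using x by auto
    have v: "hd vs \<in> V" "hd vs \<noteq> x" using ends(1) x vs_nonempty by auto
    let ?z = "nxt (vs ! 0) x"
    have z: "ht ?z + 1 = ht x" "pos ?z = pos x" using nxt_off_path[OF x'] vs_nonempty by simp_all
    have "E x ?z" using nxt(1)[OF x'(1) v(1)] v(2) hd_vs by simp
    then have "?z \<in> V" "x \<noteq> ?z" "tdist x ?z = 1" using edgeD tdist_edge by auto
    then have "1 = real (ht x) + real (ht ?z)" using d[OF x'(1), of ?z] z by simp
    then show ?thesis using z(1) by linarith
  qed
  have edge_X: "E x y \<longleftrightarrow> (pos x = 0 \<and> y = hd vs) \<or> (pos x = c - 1 \<and> y = last vs)" if x: "x \<in> X" for x y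
  proof
    assume e: "E x y"
    then have yV: "y \<in> V" "x \<noteq> y" using edgeD by auto
    have "1 = real (ht x) + real (ht y) + \<bar>P x - P y\<bar>" using d[of x y] x yV tdist_edge[OF e] by simp
    then have "real (ht y) = 0" "P x = P y" using h1[OF x] by (simp_all add: add_nonneg_eq_0_iff)
    then have "y \<in> set vs" "pos y = pos x" using ht_eq_0 yV by auto
    then have "y = vs ! pos x" by (auto simp: in_set_conv_nth pos_vs)
    then show "(pos x = 0 \<and> y = hd vs) \<or> (pos x = c - 1 \<and> y = last vs)"
      using po[OF x] hd_vs last_vs by auto
  next
    assume "(pos x = 0 \<and> y = hd vs) \<or> (pos x = c - 1 \<and> y = last vs)"
    then have y: "y = vs ! pos x" using hd_vs last_vs by auto
    have "tdist y x = 1" using h1[OF x] y by (simp add: ht_def)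
    then show "E x y" using tdist_1_iff[of y x] x y vs_in_V pos_less symE by auto
  qed
  have edge_path: "E (vs ! s) (vs ! t) \<longleftrightarrow> t = Suc s \<or> s = Suc t" if "s < c" "t < c" for s t
  proof -
    note v = vs_in_V[OF that(1)] vs_in_V[OF that(2)]
    have "real (tdist (vs ! s) (vs ! t)) = \<bar>real s - real t\<bar>"
      using tdist_vs[OF v(2) that(1)] that by (simp add: ht_vs pos_vs)
    then have "tdist (vs ! s) (vs ! t) = 1 \<longleftrightarrow> t = Suc s \<or> s = Suc t" by linarith
    then show ?thesis using tdist_1_iff[OF v] by simp
  qed
  have ev: "hd vs \<in> set vs" "last vs \<in> set vs" using vs_nonempty by auto
  show ?thesis
    unfolding brooms_def
  proof (intro allI)
    fix x y
    let ?R = "(\<exists>i. Suc i < c \<and> ((x = vs ! i \<and> y = vs ! Suc i) \<or> (y = vs ! i \<and> x = vs ! Suc i)))"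
    have R: "?R \<Longrightarrow> x \<in> set vs \<and> y \<in> set vs" by auto
    consider "x \<in> X" | "y \<in> X" | "x \<notin> V \<or> y \<notin> V" | "x \<in> set vs" "y \<in> set vs" by blast
    then show "E x y \<longleftrightarrow> ?R \<or> (x \<in> ?A \<and> y = hd vs) \<or> (y \<in> ?A \<and> x = hd vs)
     \<or> (x \<in> ?B \<and> y = last vs) \<or> (y \<in> ?B \<and> x = last vs)"
    proof cases
      case 1
      then show ?thesis using edge_X[OF 1, of y] R ev by blast
    next
      case 2
      then show ?thesis using edge_X[OF 2, of x] symE[of x y] symE[of y x] R ev by blast
    next
      case 3
      then show ?thesis using edgeD[of x y] R ends(1,2) set_vs by blast
    next
      case 4
      then obtain s t where st: "s < c" "t < c" "x = vs ! s" "y = vs ! t" by (auto simp: in_set_conv_nth)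
      have "?R \<longleftrightarrow> t = Suc s \<or> s = Suc t"
        unfolding st(3,4) using st(1,2) distinct_vs by (auto simp: nth_eq_iff_index_eq)
      then have "E x y \<longleftrightarrow> ?R" using edge_path[OF st(1,2)] unfolding st(3,4) by blast
      moreover have "x \<notin> X" "y \<notin> X" using 4 by auto
      ultimately show ?thesis by blast
    qed
  qed
qed

text \<open>The only neighbour of an off-path vertex \<open>x\<close> is \<open>vs ! t x\<close>, so
  every distance from \<open>x\<close> is 1 plus the distance from there. Positions, heights and
  vanishing excess all follow from this.\<close>

lemma brooms_imp_pos:
  assumes br: "brooms A B" and AB: "A \<inter> B = {}" "A \<union> B = X"
  shows "\<And>x y. x \<in> V \<Longrightarrow> y \<in> V \<Longrightarrow> excess x y = 0" and "\<And>x. x \<in> X \<Longrightarrow> pos x = 0 \<or> pos x = c - 1"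
    and "{x\<in>X. pos x = 0} = A"
proof -
  have ev: "hd vs \<in> set vs" "last vs \<in> set vs" using vs_nonempty by auto
  define t where "t x = (if x \<in> A then 0 else c - 1)" for x
  have tc: "t x < c" for x using vs_nonempty by (auto simp: t_def)
  have nb: "y = vs ! t x" if "x \<in> X" "E x y" for x y
  proof -
    have "x \<notin> set vs" using that(1) by blast
    moreover have "(\<exists>i. Suc i < c \<and> (x = vs ! i \<and> y = vs ! Suc i \<or> y = vs ! i \<and> x = vs ! Suc i))
       \<or> (x \<in> A \<and> y = hd vs) \<or> (y \<in> A \<and> x = hd vs) \<or> (x \<in> B \<and> y = last vs) \<or> (y \<in> B \<and> x = last vs)"
      using br that(2) unfolding brooms_def by blast
    ultimately consider "x \<in> A" "y = hd vs" | "x \<in> B" "y = last vs" using ev by auto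
    then show ?thesis
    proof cases
      case 1 then show ?thesis by (simp add: t_def hd_vs)
    next
      case 2
      then have "x \<notin> A" using AB by blast
      then show ?thesis using 2 by (simp add: t_def last_vs)
    qed
  qed
  have leaf: "tdist x y = Suc (tdist (vs ! t x) y)" if x: "x \<in> X" and y: "y \<in> V" "x \<noteq> y" for x y
  proof -
    have "x \<in> V" using x by blast
    note z = nxt[OF this y]
    show ?thesis using nb[OF x z(1)] z(2) by simp
  qed
  have ph: "pos x = t x" "ht x = 1" if x: "x \<in> X" for x
  proof -
    have xV: "x \<in> V" using x by blast
    have "real (tdist (vs ! s) x) = real 1 + \<bar>real s - real (t x)\<bar>" if s: "s < c" for s
    proof -
      note v = vs_in_V[OF s] vs_in_V[OF tc]
      have "x \<noteq> vs ! s" using x s by auto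
      from leaf[OF x v(1) this] show ?thesis
        using tdist_vs[OF v(2) s, of x] tdist_commute[OF xV v(1)] tdist_commute[OF v(2,1)]
        by (simp add: ht_vs pos_vs tc)
    qed
    from pos_ht_unique[OF xV tc this] show "pos x = t x" "ht x = 1" by auto
  qed
  show "\<And>x. x \<in> X \<Longrightarrow> pos x = 0 \<or> pos x = c - 1" using ph t_def by metis
  have c1: "c - 1 \<noteq> 0" using len by linarith
  have "pos x = 0 \<longleftrightarrow> x \<in> A" if "x \<in> X" for x using ph(1)[OF that] c1 by (simp add: t_def)
  then show "{x\<in>X. pos x = 0} = A" using AB(2) by blast
  have path_d: "real (tdist (vs ! s) y) = real (ht y) + \<bar>real s - P y\<bar>" if "s < c" "y \<in> V" for s y
    using tdist_vs that by simp
  fix x y assume x: "x \<in> V" and y: "y \<in> V"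
  show "excess x y = 0"
  proof (cases "x = y")
    case False
    have "real (tdist x y) = real (ht x) + real (ht y) + \<bar>P x - P y\<bar>"
    proof (cases "x \<in> X")
      case True
      then show ?thesis using leaf[OF True y False] path_d[OF tc y, of x] ph[OF True] by simp
    next
      case xp: False
      then obtain s where "s < c" "x = vs ! s" using x by (auto simp: in_set_conv_nth)
      then show ?thesis using path_d[OF _ y] by (simp add: ht_vs pos_vs)
    qed
    then show ?thesis by (simp add: excess_def)
  qed (simp add: excess_def)
qed

lemma extremal_iff:
  "extremal \<longleftrightarrow> (\<exists>A B. A \<inter> B = {} \<and> A \<union> B = X \<and>
     (card A = (n - c) div 2 \<and> card B = n - c - (n - c) div 2 \<or> card A = n - c - (n - c) div 2 \<and> card B = (n - c) div 2)
     \<and> brooms A B)"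
proof
  assume e: extremal
  let ?A = "{x\<in>X. pos x = 0}" and ?B = "{x\<in>X. pos x = c - 1}"
  have po: "pos x = 0 \<or> pos x = c - 1" if "x \<in> X" for x using e that by (auto simp: extremal_def)
  have c1: "0 \<noteq> c - 1" using len by linarith
  have AB: "?A \<inter> ?B = {}" "?A \<union> ?B = X" using po c1 by auto
  have "card ?A + card ?B = n - c"
    using card_Un_disjoint[OF _ _ AB(1)] fin unfolding AB(2) card_X by simp
  moreover have "card ?A = (n - c) div 2 \<or> card ?A = n - c - (n - c) div 2" using e unfolding extremal_def by blast
  ultimately have "card ?A = (n - c) div 2 \<and> card ?B = n - c - (n - c) div 2 \<or> card ?A = n - c - (n - c) div 2 \<and> card ?B = (n - c) div 2"
    by linarith
  moreover have "brooms ?A ?B" using e po unfolding extremal_def by (intro extremal_imp_brooms) blast+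
  ultimately show "\<exists>A B. A \<inter> B = {} \<and> A \<union> B = X \<and>
     (card A = (n - c) div 2 \<and> card B = n - c - (n - c) div 2 \<or> card A = n - c - (n - c) div 2 \<and> card B = (n - c) div 2)
     \<and> brooms A B" using AB by blast
next
  assume "\<exists>A B. A \<inter> B = {} \<and> A \<union> B = X \<and>
     (card A = (n - c) div 2 \<and> card B = n - c - (n - c) div 2 \<or> card A = n - c - (n - c) div 2 \<and> card B = (n - c) div 2)
     \<and> brooms A B"
  then obtain A B where AB: "A \<inter> B = {}" "A \<union> B = X" and br: "brooms A B"
    and k: "card A = (n - c) div 2 \<or> card A = n - c - (n - c) div 2" by blast
  show extremal unfolding extremal_def brooms_imp_pos(3)[OF br AB]
    using brooms_imp_pos(1,2)[OF br AB] k by blast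
qed

end

theorem theorem4p1:
  fixes V :: "'a set" and E :: "'a \<Rightarrow> 'a \<Rightarrow> bool" and vs :: "'a list"
  assumes tree: "is_tree V E"
    and n4: "card V \<ge> 4"
    and path: "is_path E vs" and ne: "vs \<noteq> []"
    and distinct_ends: "hd vs \<noteq> last vs"
    and nonadj: "\<not> E (hd vs) (last vs)"
  shows "let n = card V; c = length vs;
             fl = \<lfloor>(real n - real c) / 2\<rfloor>; cl = \<lceil>(real n - real c) / 2\<rceil>;
             bound = (1 / (4 * real c * real n * (real n - 1))) *
               (- (2/3) * (real n + 1) * (real c)^2 * ((real c)^2 - 1)
                - 8 * (real n - real c) * (- real n * (real c)^2
                     + real c * (real c + 1) / 6 * ((2 * real n + 1) * real c + real n - 1))
                - 8 * real_of_int fl * real_of_int cl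
                     * ((real n - 1) * (real c - 1)^2 + real c * (real c - 1))
                + 4 * real n * (real n - 1) * real c * (real c - 1)
                + 2 * (real n - 1) * (real c)^2);
             G = add_edge E (hd vs) (last vs)
         in kemeny V G - kemeny V E \<ge> bound \<and>
            (kemeny V G - kemeny V E = bound \<longleftrightarrow>
              (\<exists>A B. A \<inter> B = {} \<and> A \<union> B = V - set vs \<and>
                 ((int (card A) = fl \<and> int (card B) = cl) \<or> (int (card A) = cl \<and> int (card B) = fl)) \<and>
                 (\<forall>x y. E x y \<longleftrightarrow>
                    (\<exists>i. Suc i < c \<and> ((x = vs ! i \<and> y = vs ! Suc i) \<or> (y = vs ! i \<and> x = vs ! Suc i)))
                    \<or> (x \<in> A \<and> y = hd vs) \<or> (y \<in> A \<and> x = hd vs)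
                    \<or> (x \<in> B \<and> y = last vs) \<or> (y \<in> B \<and> x = last vs))))"
proof -
  \<comment> \<open>A single vertex contradicts distinct ends, two vertices contradict
    non-adjacency.\<close>
  have "3 \<le> length vs"
  proof (rule ccontr)
    assume "\<not> 3 \<le> length vs"
    then consider "length vs = 0" | "length vs = 1" | "length vs = 2" by linarith
    then show False
      using ne distinct_ends nonadj path
      by cases (auto simp: length_Suc_conv is_path_Cons eval_nat_numeral)
  qed
  then interpret tree_with_path V E vs
    using tree path nonadj by unfold_locales
  define m where "m = n - c"
  have nc: "real n - real c = real m" unfolding m_def using c_le_n by (simp add: of_nat_diff)
  \<comment> \<open>The real floor and ceiling become the natural numbers \<open>m div 2\<close> and
    \<open>m - m div 2\<close> used in \<open>balanced_product\<close>.\<close>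
  have fl: "\<lfloor>real m / 2\<rfloor> = int (m div 2)" by linarith
  have cl: "\<lceil>real m / 2\<rceil> = int (m - m div 2)" by linarith
  have n1: "real n * (real n - 1) > 0" using c_le_n len by simp
  have *: "k \<ge> b \<and> (k = b \<longleftrightarrow> s = 0)" if "k = b + s / (real n * (real n - 1))" "s \<ge> 0" for k b s :: real
    using that n1 by auto
  show ?thesis
    unfolding Let_def nc fl cl
    using *[OF kemeny_diff_bound slack(1)]
    unfolding slack(2) extremal_iff brooms_def nc m_def[symmetric] of_int_of_nat_eq of_nat_eq_iff
    by blast
qed

end
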